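(* Let $\mathfrak g$ be the affine Lie algebra of type $\mathrm D^{(2)}_{n}$ ($n\ge 3$) with index set $I=\{1,\dots,n\}$, and let $\iota=(\cdots,i_3,i_2,i_1)$ be an infinite sequence of elements of $I$ which is adapted to the generalized Cartan matrix of $\mathfrak g$. Then $\iota$ satisfies the $\Xi'$-positivity condition and $$\mathrm{Im}(\Psi_\iota)=\left\{\mathbf a\in\mathbb Z^\infty \;\middle|\; L_{s,k,\iota}(T)(\mathbf a)\ge 0\ \text{ for all } k\in I,\ s\in\mathbb Z_{\ge1},\ T\in \mathrm{EYD}_k\right\}.$$
   Context: **Cartan matrix.** $a_{i,j}=\langle h_i,\alpha_j\rangle$, $I=\{1,\dots,n\}$. Type $\mathrm D^{(2)}_{n}$ ($n\ge3$): $a_{i,i}=2$; $a_{i,j}=-1$ if $|i-j|=1$ except $a_{1,2}=-2$ and $a_{n,n-1}=-2$; all other entries are $0$. **Sequences.** All sequences $\iota=(\cdots,i_k,\cdots,i_2,i_1)$ of elements of $I$ are assumed to satisfy: $i_k\ne i_{k+1}$ for all $k$ and $\#\{k: i_k=i\}=\infty$ for every $i\in I$. $\iota$ is *adapted* if for all $i,j\in I$ with $a_{i,j}<0$ the subsequence of $\iota$ consisting of all $i$'s and $j$'s is $(\cdots,i,j,i,j)$ or $(\cdots,j,i,j,i)$. For $i,j$ with $a_{i,j}<0$ put $p_{i,j}=1$ if this subsequence is $(\cdots,j,i,j,i)$ (last entry $i$) and $p_{i,j}=0$ if it is $(\cdots,i,j,i,j)$ (last entry $j$). **Crystal $\mathbb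 Z^\infty_\iota$ and $\Psi_\iota$.** $\mathbb Z^\infty=\{(\cdots,a_k,\cdots,a_2,a_1): a_k\in\mathbb Z,\ a_k=0 \text{ for } k\gg0\}$; $\mathbb Q^\infty$ is defined likewise with $a_k\in\mathbb Q$. For $\mathbf a\in\mathbb Z^\infty$, $k\ge1$ put $\sigma_k(\mathbf a)=a_k+\sum_{j>k}\langle h_{i_k},\alpha_{i_j}\rangle a_j$. Define $\mathrm{wt}(\mathbf a)=-\sum_{j\ge1}a_j\alpha_{i_j}$, $\varepsilon_i(\mathbf a)=\max\{\sigma_k(\mathbf a): k\ge 1,\ i_k=i\}$, $\varphi_i(\mathbf a)=\langle h_i,\mathrm{wt}(\mathbf a)\rangle+\varepsilon_i(\mathbf a)$, $M^{(i)}=\{k: i_k=i,\ \sigma_k(\mathbf a)=\varepsilon_i(\mathbf a)\}$, $(\tilde f_i\mathbf a)_k=a_k+\delta_{k,\min M^{(i)}}$, and $(\tilde e_i\mathbf a)_k=a_k-\delta_{k,\max M^{(i)}}$ if $\varepsilon_i(\mathbf a)>0$, $\tilde e_i\mathbf a=0$ if $\varepsilon_i(\mathbf a)=0$. This makes $\mathbb Z^\infty$ a crystal, denoted $\mathbb Z^\infty_\iota$. Let $B(\infty)$ be Kashiwara's crystal base of $U_q^-(\mathfrak g)$ and $u_\infty$ its highest weight vector. $\Psi_\iota:B(\infty)\hookrightarrow\mathbb Z^\infty_\iota$ denotes the unique strict embedding of crystals (injective map preserving $\mathrm{wt},\varepsilon_i,\varphi_i$ and commuting with all $\tilde e_i,\tilde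 f_i$, where $0\mapsto0$) with $\Psi_\iota(u_\infty)=(\cdots,0,0)$ (its existence and uniqueness are known). **Operators $S'_k$ and $\Xi'$-positivity.** $x_k\in(\mathbb Q^\infty)^*$ is $x_k(\mathbf a)=a_k$ for $k\ge1$. Let $k^{(+)}=\min\{l>k: i_l=i_k\}$, $k^{(-)}=\max(\{1\le l<k: i_l=i_k\}\cup\{0\})$, $\beta_k=x_k+\sum_{k<j<k^{(+)}}\langle h_{i_k},\alpha_{i_j}\rangle x_j+x_{k^{(+)}}$ for $k\ge1$, $\beta_0=0$. For $\varphi=\sum_k c_kx_k$ set $S'_k(\varphi)=\varphi-\beta_k$ if $c_k>0$, $S'_k(\varphi)=\varphi+\beta_{k^{(-)}}$ if $c_k<0$, $S'_k(\varphi)=\varphi$ if $c_k=0$. Let $\Xi'_\iota=\{S'_{j_l}\cdots S'_{j_1}x_{j_0}: l\ge0,\ j_0,\dots,j_l\ge1\}$. $\iota$ satisfies the *$\Xi'$-positivity condition* if for every $\varphi=\sum_kc_kx_k\in\Xi'_\iota$ and every $k$ with $k^{(-)}=0$ one has $c_k\ge0$. **Double indices.** The index $j\in\mathbb Z_{\ge1}$ is identified with $(s,l)\in\mathbb Z_{\ge1}\times I$ if $i_j=l$ and $l$ occurs exactly $s$ times in $i_j,i_{j-1},\dots,i_1$; then $x_{s,l}:=x_j$. **Extended Young diagrams.** $\mathrm{EYD}_k$ is the set of sequences $T=(y_m)_{m\in\mathbb Z_{\ge0}}$ of integers with $y_m\le y_{m+1}$ for all $m$ and $y_m=y_\infty:=k$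 for $m\gg0$. If $y_m<y_{m+1}$, then $(m+1,y_m)$ is a *convex corner* and $(m+1,y_{m+1})$ a *concave corner* of $T$; $(0,y_0)$ is also a concave corner. **Assignment.** $\pi:\mathbb Z\to I$ is the map of period $2n-2$ with $\pi(1)=1$, $\pi(n)=n$, $\pi(l)=\pi(2n-l)=l$ for $2\le l\le n-1$. For $k\in I$ put $P^k(k)=0$, $P^k(t)=P^k(t-1)+p_{\pi(t),\pi(t-1)}$ for $t>k$, $P^k(t)=P^k(t+1)+p_{\pi(t),\pi(t+1)}$ for $t<k$. For an integer point $(i,j)$ and $s\in\mathbb Z_{\ge1}$, $L_{s,k,\iota}(i,j)=x_{s+P^k(i+j)+\min\{k-j,i\},\ \pi(i+j)}$ (for corners of $T\in\mathrm{EYD}_k$ the first index is $\ge1$). For $T\in\mathrm{EYD}_k$, $$L_{s,k,\iota}(T)=\sum_{P\text{ concave corner of }T}L_{s,k,\iota}(P)-\sum_{P\text{ convex corner of }T}L_{s,k,\iota}(P)\in(\mathbb Q^\infty)^*.$$ *)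

theory Defs
  imports
    "HOL-Algebra.QuotRing"
    "HOL-Algebra.Generated_Rings"
    "HOL-Library.Poly_Mapping"
    "HOL-Library.Infinite_Set"
    "HOL-Computational_Algebra.Polynomial"
    "HOL-Computational_Algebra.Fraction_Field"
begin

section \<open>Cartan datum of type $D^{(2)}_n$\<close>

definition cartan :: "nat \<Rightarrow> nat \<Rightarrow> nat \<Rightarrow> int" where
  "cartan n i j =
     (if i = j then 2
      else if (i = 1 \<and> j = 2) \<or> (i = n \<and> j + 1 = n) then -2
      else if j = i + 1 \<or> i = j + 1 then -1
      else 0)"

text \<open>The symmetrizer $d_i = (\alpha_i,\alpha_i)/2$, i.e. $d_i a_{i,j} = d_j a_{j,i}$.\<close>
definition symmetrizer :: "nat \<Rightarrow> nat \<Rightarrow> int" where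
  "symmetrizer n i = (if i = 1 \<or> i = n then 1 else 2)"

text \<open>
  The root lattice is free on $\alpha_1,\dots,\alpha_n$, an element being given by its coefficients.
  The dual weight lattice is free on $h_1,\dots,h_n$ and the scaling element $d$ with
  $\langle d,\alpha_j\rangle = \delta_{j,1}$; the coefficient at index $0$ is that of $d$.
  With $d$ included, the $\alpha_j$ are linearly independent as functionals on this lattice.
\<close>
type_synonym root = "nat \<Rightarrow>\<^sub>0 int"
type_synonym coweight = "nat \<Rightarrow>\<^sub>0 int"

definition root_lattice :: "nat \<Rightarrow> root set" where
  "root_lattice n = {\<xi>. Poly_Mapping.keys \<xi> \<subseteq> {1..n}}"

definition coweight_lattice :: "nat \<Rightarrow> coweight set" where
  "coweight_lattice n = {h. Poly_Mapping.keys h \<subseteq> {0..n}}"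

definition simple_root :: "nat \<Rightarrow> root" where
  "simple_root i = Poly_Mapping.single i 1"

definition simple_coroot :: "nat \<Rightarrow> coweight" where
  "simple_coroot i = Poly_Mapping.single i 1"

definition pairing :: "nat \<Rightarrow> coweight \<Rightarrow> root \<Rightarrow> int" where
  "pairing n h \<xi> =
     (\<Sum>i\<in>Poly_Mapping.keys h. \<Sum>j\<in>Poly_Mapping.keys \<xi>.
        Poly_Mapping.lookup h i * Poly_Mapping.lookup \<xi> j *
        (if i = 0 then (if j = 1 then 1 else 0) else cartan n i j))"


section \<open>The quantized enveloping algebra\<close>

type_synonym qfield = "rat poly fract"

definition qq :: qfield where
  "qq = Fract [:0, 1:] 1"

definition qi :: "nat \<Rightarrow> nat \<Rightarrow> qfield" where
  "qi n i = qq powi symmetrizer n i"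

definition qint :: "nat \<Rightarrow> nat \<Rightarrow> nat \<Rightarrow> qfield" where
  "qint n i m = (qi n i ^ m - inverse (qi n i) ^ m) / (qi n i - inverse (qi n i))"

definition qfact :: "nat \<Rightarrow> nat \<Rightarrow> nat \<Rightarrow> qfield" where
  "qfact n i m = (\<Prod>k=1..m. qint n i k)"

text \<open>The generators $e_i$, $f_i$ and $q^h$.\<close>
datatype gen = GE nat | GF nat | GQ coweight

text \<open>The free monoid, written additively so that \<open>word \<Rightarrow>\<^sub>0 qfield\<close> is its monoid algebra.\<close>
datatype word = Word (letters: "gen list")

instantiation word :: monoid_add
begin
definition zero_word :: word where "0 = Word []"
definition plus_word :: "word \<Rightarrow> word \<Rightarrow> word" where "u + v = Word (letters u @ letters v)"
instance by standard (simp_all add: zero_word_def plus_word_def)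
end

type_synonym free = "word \<Rightarrow>\<^sub>0 qfield"

definition gens :: "nat \<Rightarrow> gen set" where
  "gens n = GE ` {1..n} \<union> GF ` {1..n} \<union> GQ ` coweight_lattice n"

definition free_algebra :: "nat \<Rightarrow> free ring" where
  "free_algebra n =
     \<lparr>carrier = {x. \<forall>w\<in>Poly_Mapping.keys x. set (letters w) \<subseteq> gens n},
      monoid.mult = (*), one = 1, zero = 0, add = (+)\<rparr>"

lemma ring_free_algebra: "ring (free_algebra n)"
proof (rule ringI)
  have keys1: "Poly_Mapping.keys (1 :: free) = {0}"
    by (simp add: single_one [symmetric] del: single_one)
  show "abelian_group (free_algebra n)"
  proof (rule abelian_groupI)
    fix x assume x: "x \<in> carrier (free_algebra n)"
    have "- x \<in> carrier (free_algebra n)"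
      using x by (auto simp: free_algebra_def keys_minus)
    then show "\<exists>y\<in>carrier (free_algebra n). y \<oplus>\<^bsub>free_algebra n\<^esub> x = \<zero>\<^bsub>free_algebra n\<^esub>"
      by (intro bexI[of _ "- x"]) (auto simp: free_algebra_def)
  next
    fix x y assume "x \<in> carrier (free_algebra n)" "y \<in> carrier (free_algebra n)"
    then show "x \<oplus>\<^bsub>free_algebra n\<^esub> y \<in> carrier (free_algebra n)"
      using Poly_Mapping.keys_add[of x y] by (auto simp: free_algebra_def)
  qed (auto simp: free_algebra_def algebra_simps)
  show "Group.monoid (free_algebra n)"
  proof (rule monoidI)
    fix x y assume "x \<in> carrier (free_algebra n)" "y \<in> carrier (free_algebra n)"
    then show "x \<otimes>\<^bsub>free_algebra n\<^esub> y \<in> carrier (free_algebra n)"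
      using keys_mult[of x y] by (fastforce simp: free_algebra_def plus_word_def)
  qed (auto simp: free_algebra_def keys1 zero_word_def mult.assoc)
qed (auto simp: free_algebra_def algebra_simps)

definition fscal :: "qfield \<Rightarrow> free" where
  "fscal c = Poly_Mapping.single 0 c"

definition fgen :: "gen \<Rightarrow> free" where
  "fgen g = Poly_Mapping.single (Word [g]) 1"

abbreviation "fe i \<equiv> fgen (GE i)"
abbreviation "ff i \<equiv> fgen (GF i)"
abbreviation "fq h \<equiv> fgen (GQ h)"

text \<open>The exponent of $t_i = q_i^{h_i} = q^{d_i h_i}$.\<close>
definition tcow :: "nat \<Rightarrow> nat \<Rightarrow> coweight" where
  "tcow n i = Poly_Mapping.single i (symmetrizer n i)"

text \<open>Divided power $x^m/[m]_i!$.\<close>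
definition divpow :: "nat \<Rightarrow> nat \<Rightarrow> free \<Rightarrow> nat \<Rightarrow> free" where
  "divpow n i x m = fscal (inverse (qfact n i m)) * x ^ m"

definition serre :: "nat \<Rightarrow> nat \<Rightarrow> nat \<Rightarrow> free \<Rightarrow> free \<Rightarrow> free" where
  "serre n i j x y =
     (let b = nat (1 - cartan n i j)
      in \<Sum>k\<le>b. (- 1) ^ k * divpow n i x k * y * divpow n i x (b - k))"

definition relators :: "nat \<Rightarrow> free set" where
  "relators n =
     {fq 0 - 1}
     \<union> {fq h * fq h' - fq (h + h') | h h'. h \<in> coweight_lattice n \<and> h' \<in> coweight_lattice n}
     \<union> {fq h * fe i * fq (- h) - fscal (qq powi pairing n h (simple_root i)) * fe i
          | h i. h \<in> coweight_lattice n \<and> i \<in> {1..n}}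
     \<union> {fq h * ff i * fq (- h) - fscal (qq powi (- pairing n h (simple_root i))) * ff i
          | h i. h \<in> coweight_lattice n \<and> i \<in> {1..n}}
     \<union> {fe i * ff j - ff j * fe i
          - (if i = j then fscal (inverse (qi n i - inverse (qi n i)))
                             * (fq (tcow n i) - fq (- tcow n i))
             else 0)
          | i j. i \<in> {1..n} \<and> j \<in> {1..n}}
     \<union> {serre n i j (fe i) (fe j) | i j. i \<in> {1..n} \<and> j \<in> {1..n} \<and> i \<noteq> j}
     \<union> {serre n i j (ff i) (ff j) | i j. i \<in> {1..n} \<and> j \<in> {1..n} \<and> i \<noteq> j}"

lemma relators_in_carrier: "relators n \<subseteq> carrier (free_algebra n)"
proof -
  interpret R: ring "free_algebra n" by (rule ring_free_algebra)
  let ?C = "carrier (free_algebra n)"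
  have one: "1 \<in> ?C" and zero: "0 \<in> ?C"
    using R.one_closed R.zero_closed by (simp_all add: free_algebra_def)
  have add: "x + y \<in> ?C" and mult: "x * y \<in> ?C" if "x \<in> ?C" "y \<in> ?C" for x y
    using R.a_closed[OF that] R.m_closed[OF that] by (simp_all add: free_algebra_def)
  have minus: "- x \<in> ?C" if "x \<in> ?C" for x
    using that by (auto simp: free_algebra_def keys_minus)
  have diff: "x - y \<in> ?C" if "x \<in> ?C" "y \<in> ?C" for x y
    using add[OF that(1) minus[OF that(2)]] by simp
  have pow: "x ^ m \<in> ?C" if "x \<in> ?C" for x m
    by (induction m) (use that one mult in auto)
  have sum: "(\<Sum>k\<le>b. f k) \<in> ?C" if "\<And>k. f k \<in> ?C" for f and b :: nat
    by (induction b) (use that add in auto)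
  have scal: "fscal c \<in> ?C" for c
    by (auto simp: fscal_def free_algebra_def zero_word_def)
  have gen: "fgen g \<in> ?C" if "g \<in> gens n" for g
    using that by (auto simp: fgen_def free_algebra_def)
  have ef: "fe i \<in> ?C" "ff i \<in> ?C" if "i \<in> {1..n}" for i
    using that by (auto intro!: gen simp: gens_def)
  have q: "fq h \<in> ?C" "fq (- h) \<in> ?C" if "h \<in> coweight_lattice n" for h
    using that by (auto intro!: gen simp: gens_def coweight_lattice_def keys_minus)
  have qadd: "h + h' \<in> coweight_lattice n"
    if "h \<in> coweight_lattice n" "h' \<in> coweight_lattice n" for h h'
    using that Poly_Mapping.keys_add[of h h'] unfolding coweight_lattice_def by blast
  have q0: "fq 0 \<in> ?C"
    by (intro q) (simp add: coweight_lattice_def)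
  have t: "tcow n i \<in> coweight_lattice n" if "i \<in> {1..n}" for i
    using that by (auto simp: tcow_def coweight_lattice_def)
  have serre: "serre n i j x y \<in> ?C" if "x \<in> ?C" "y \<in> ?C" for i j x y
    unfolding serre_def divpow_def Let_def
    by (intro sum mult pow minus one scal that)
  show ?thesis
    unfolding relators_def
    using zero
    by (auto intro!: diff mult one zero scal ef q qadd q0 t serre simp del: atLeastAtMost_iff)
qed

type_synonym uq = "free set"

definition rel_ideal :: "nat \<Rightarrow> free set" where
  "rel_ideal n = Idl\<^bsub>free_algebra n\<^esub> (relators n)"

definition Uq :: "nat \<Rightarrow> uq ring" where
  "Uq n = free_algebra n Quot rel_ideal n"

definition cls :: "nat \<Rightarrow> free \<Rightarrow> uq" where
  "cls n x = rel_ideal n +>\<^bsub>free_algebra n\<^esub> x"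

definition smul :: "nat \<Rightarrow> qfield \<Rightarrow> uq \<Rightarrow> uq" where
  "smul n c x = cls n (fscal c) \<otimes>\<^bsub>Uq n\<^esub> x"

definition Uq_minus :: "nat \<Rightarrow> uq set" where
  "Uq_minus n =
     generate_ring (Uq n) (range (\<lambda>c. cls n (fscal c)) \<union> (\<lambda>i. cls n (ff i)) ` {1..n})"

definition Uq_minus_weight :: "nat \<Rightarrow> root \<Rightarrow> uq set" where
  "Uq_minus_weight n \<xi> =
     {x \<in> Uq_minus n. \<forall>h\<in>coweight_lattice n.
        cls n (fq h) \<otimes>\<^bsub>Uq n\<^esub> x \<otimes>\<^bsub>Uq n\<^esub> cls n (fq (- h)) = smul n (qq powi pairing n h \<xi>) x}"


section \<open>Kashiwara's crystal base of the negative half\<close>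

text \<open>
  Kashiwara's $e_i'$ is determined by
  $[e_i, P] = (t_i\, e_i''(P) - t_i^{-1} e_i'(P)) / (q_i - q_i^{-1})$
  with $e_i'(P), e_i''(P) \in U_q^-$.
\<close>
definition e_prime :: "nat \<Rightarrow> nat \<Rightarrow> uq \<Rightarrow> uq" where
  "e_prime n i P =
     (THE R. R \<in> Uq_minus n \<and>
        (\<exists>Q\<in>Uq_minus n.
           (cls n (fe i) \<otimes>\<^bsub>Uq n\<^esub> P) \<ominus>\<^bsub>Uq n\<^esub> (P \<otimes>\<^bsub>Uq n\<^esub> cls n (fe i)) =
           smul n (inverse (qi n i - inverse (qi n i)))
             ((cls n (fq (tcow n i)) \<otimes>\<^bsub>Uq n\<^esub> Q) \<ominus>\<^bsub>Uq n\<^esub> (cls n (fq (- tcow n i)) \<otimes>\<^bsub>Uq n\<^esub> R))))"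

definition fdiv :: "nat \<Rightarrow> nat \<Rightarrow> nat \<Rightarrow> uq" where
  "fdiv n i m = cls n (divpow n i (ff i) m)"

text \<open>The components $u_m$ of the decomposition $u = \sum_m f_i^{(m)} u_m$ with $e_i' u_m = 0$.\<close>
definition kash_components :: "nat \<Rightarrow> nat \<Rightarrow> uq \<Rightarrow> nat \<Rightarrow> uq" where
  "kash_components n i u =
     (THE c. (\<forall>m. c m \<in> Uq_minus n \<and> e_prime n i (c m) = \<zero>\<^bsub>Uq n\<^esub>)
        \<and> finite {m. c m \<noteq> \<zero>\<^bsub>Uq n\<^esub>}
        \<and> u = (\<Oplus>\<^bsub>Uq n\<^esub>m\<in>{m. c m \<noteq> \<zero>\<^bsub>Uq n\<^esub>}. fdiv n i m \<otimes>\<^bsub>Uq n\<^esub> c m))"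

definition ftil :: "nat \<Rightarrow> nat \<Rightarrow> uq \<Rightarrow> uq" where
  "ftil n i u =
     (let c = kash_components n i u
      in \<Oplus>\<^bsub>Uq n\<^esub>m\<in>{m. c m \<noteq> \<zero>\<^bsub>Uq n\<^esub>}. fdiv n i (m + 1) \<otimes>\<^bsub>Uq n\<^esub> c m)"

definition etil :: "nat \<Rightarrow> nat \<Rightarrow> uq \<Rightarrow> uq" where
  "etil n i u =
     (let c = kash_components n i u
      in \<Oplus>\<^bsub>Uq n\<^esub>m\<in>{m. c m \<noteq> \<zero>\<^bsub>Uq n\<^esub> \<and> 0 < m}. fdiv n i (m - 1) \<otimes>\<^bsub>Uq n\<^esub> c m)"

definition regular_at_0 :: "qfield set" where
  "regular_at_0 = {c. \<exists>a b. poly b 0 \<noteq> 0 \<and> c = Fract a b}"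

inductive_set ftil_words :: "nat \<Rightarrow> uq set" for n where
  one: "\<one>\<^bsub>Uq n\<^esub> \<in> ftil_words n"
| step: "x \<in> ftil_words n \<Longrightarrow> i \<in> {1..n} \<Longrightarrow> ftil n i x \<in> ftil_words n"

text \<open>The crystal lattice $L(\infty)$, the span of \<^const>\<open>ftil_words\<close> over \<^const>\<open>regular_at_0\<close>.\<close>
inductive_set L_inf :: "nat \<Rightarrow> uq set" for n where
  zero: "\<zero>\<^bsub>Uq n\<^esub> \<in> L_inf n"
| add: "x \<in> L_inf n \<Longrightarrow> c \<in> regular_at_0 \<Longrightarrow> w \<in> ftil_words n \<Longrightarrow>
        x \<oplus>\<^bsub>Uq n\<^esub> smul n c w \<in> L_inf n"

definition qL_inf :: "nat \<Rightarrow> uq set" where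
  "qL_inf n = smul n qq ` L_inf n"

text \<open>The class of an element of $L(\infty)$ in $L(\infty)/qL(\infty)$; the zero class is \<^const>\<open>qL_inf\<close>.\<close>
definition modq :: "nat \<Rightarrow> uq \<Rightarrow> uq set" where
  "modq n x = qL_inf n +>\<^bsub>Uq n\<^esub> x"

definition ftil0 :: "nat \<Rightarrow> nat \<Rightarrow> uq set \<Rightarrow> uq set" where
  "ftil0 n i b = (\<Union>x\<in>b. modq n (ftil n i x))"

definition etil0 :: "nat \<Rightarrow> nat \<Rightarrow> uq set \<Rightarrow> uq set" where
  "etil0 n i b = (\<Union>x\<in>b. modq n (etil n i x))"

definition u_inf :: "nat \<Rightarrow> uq set" where
  "u_inf n = modq n \<one>\<^bsub>Uq n\<^esub>"

text \<open>
  $B(\infty)$ consists of the nonzero vectors $\tilde f_{i_1}\cdots\tilde f_{i_l}u_\infty$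
  of $L(\infty)/qL(\infty)$.
\<close>
inductive_set B_inf :: "nat \<Rightarrow> uq set set" for n where
  base: "u_inf n \<in> B_inf n"
| step: "b \<in> B_inf n \<Longrightarrow> i \<in> {1..n} \<Longrightarrow> ftil0 n i b \<noteq> qL_inf n \<Longrightarrow> ftil0 n i b \<in> B_inf n"


section \<open>Crystals\<close>

text \<open>The operators take the value \<^const>\<open>None\<close> where the mathematical ones give $0$.\<close>
record 'b crystal =
  elems :: "'b set"
  wt :: "'b \<Rightarrow> root"
  eps :: "nat \<Rightarrow> 'b \<Rightarrow> int"
  phi :: "nat \<Rightarrow> 'b \<Rightarrow> int"
  et :: "nat \<Rightarrow> 'b \<Rightarrow> 'b option"
  ft :: "nat \<Rightarrow> 'b \<Rightarrow> 'b option"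

definition strict_embedding ::
  "nat set \<Rightarrow> 'b crystal \<Rightarrow> 'c crystal \<Rightarrow> ('b \<Rightarrow> 'c) \<Rightarrow> bool" where
  "strict_embedding I B C \<Psi> \<longleftrightarrow>
     \<Psi> ` elems B \<subseteq> elems C \<and> inj_on \<Psi> (elems B) \<and>
     (\<forall>b\<in>elems B. wt C (\<Psi> b) = wt B b \<and>
        (\<forall>i\<in>I. eps C i (\<Psi> b) = eps B i b \<and> phi C i (\<Psi> b) = phi B i b \<and>
               et C i (\<Psi> b) = map_option \<Psi> (et B i b) \<and>
               ft C i (\<Psi> b) = map_option \<Psi> (ft B i b)))"

definition B_inf_wt :: "nat \<Rightarrow> uq set \<Rightarrow> root" where
  "B_inf_wt n b = (THE \<xi>. \<xi> \<in> root_lattice n \<and> (\<exists>x\<in>b. x \<in> Uq_minus_weight n \<xi>))"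

definition B_inf_eps :: "nat \<Rightarrow> nat \<Rightarrow> uq set \<Rightarrow> int" where
  "B_inf_eps n i b = int (Max {k. (etil0 n i ^^ k) b \<noteq> qL_inf n})"

definition nonzero_class :: "nat \<Rightarrow> uq set \<Rightarrow> uq set option" where
  "nonzero_class n b = (if b = qL_inf n then None else Some b)"

definition B_inf_crystal :: "nat \<Rightarrow> uq set crystal" where
  "B_inf_crystal n =
     \<lparr>elems = B_inf n,
      wt = B_inf_wt n,
      eps = B_inf_eps n,
      phi = (\<lambda>i b. B_inf_eps n i b + pairing n (simple_coroot i) (B_inf_wt n b)),
      et = (\<lambda>i b. nonzero_class n (etil0 n i b)),
      ft = (\<lambda>i b. nonzero_class n (ftil0 n i b))\<rparr>"


section \<open>Sequences\<close>

text \<open>A sequence is a function on positive indices; its value at $0$ is irrelevant.\<close>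
definition index_sequence :: "nat \<Rightarrow> (nat \<Rightarrow> nat) \<Rightarrow> bool" where
  "index_sequence n \<iota> \<longleftrightarrow>
     (\<forall>k\<ge>1. \<iota> k \<in> {1..n}) \<and> (\<forall>k\<ge>1. \<iota> k \<noteq> \<iota> (k + 1)) \<and>
     (\<forall>i\<in>{1..n}. infinite {k. 1 \<le> k \<and> \<iota> k = i})"

text \<open>The \<open>m\<close>-th entry, from the right and counted from $0$, of the subsequence of all $i$'s and $j$'s.\<close>
definition subseq2 :: "(nat \<Rightarrow> nat) \<Rightarrow> nat \<Rightarrow> nat \<Rightarrow> nat \<Rightarrow> nat" where
  "subseq2 \<iota> i j m = \<iota> (enumerate {k. 1 \<le> k \<and> \<iota> k \<in> {i, j}} m)"

definition adapted :: "nat \<Rightarrow> (nat \<Rightarrow> nat) \<Rightarrow> bool" where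
  "adapted n \<iota> \<longleftrightarrow>
     (\<forall>i\<in>{1..n}. \<forall>j\<in>{1..n}. cartan n i j < 0 \<longrightarrow>
        (\<forall>m. subseq2 \<iota> i j m = (if even m then j else i)) \<or>
        (\<forall>m. subseq2 \<iota> i j m = (if even m then i else j)))"

definition p_idx :: "(nat \<Rightarrow> nat) \<Rightarrow> nat \<Rightarrow> nat \<Rightarrow> int" where
  "p_idx \<iota> i j = (if \<forall>m. subseq2 \<iota> i j m = (if even m then i else j) then 1 else 0)"


section \<open>The crystal on integer sequences\<close>

text \<open>Entries are indexed by the positive integers, hence the condition at index $0$.\<close>
definition Z_inf :: "(nat \<Rightarrow>\<^sub>0 int) set" where
  "Z_inf = {a. Poly_Mapping.lookup a 0 = 0}"

definition sigma :: "nat \<Rightarrow> (nat \<Rightarrow> nat) \<Rightarrow> nat \<Rightarrow> (nat \<Rightarrow>\<^sub>0 int) \<Rightarrow> int" where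
  "sigma n \<iota> k a =
     Poly_Mapping.lookup a k +
     (\<Sum>j\<in>{j \<in> Poly_Mapping.keys a. k < j}. cartan n (\<iota> k) (\<iota> j) * Poly_Mapping.lookup a j)"

definition Z_wt :: "(nat \<Rightarrow> nat) \<Rightarrow> (nat \<Rightarrow>\<^sub>0 int) \<Rightarrow> root" where
  "Z_wt \<iota> a = - (\<Sum>j\<in>Poly_Mapping.keys a. Poly_Mapping.single (\<iota> j) (Poly_Mapping.lookup a j))"

definition Z_eps :: "nat \<Rightarrow> (nat \<Rightarrow> nat) \<Rightarrow> nat \<Rightarrow> (nat \<Rightarrow>\<^sub>0 int) \<Rightarrow> int" where
  "Z_eps n \<iota> i a = Max ((\<lambda>k. sigma n \<iota> k a) ` {k. 1 \<le> k \<and> \<iota> k = i})"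

definition Z_M :: "nat \<Rightarrow> (nat \<Rightarrow> nat) \<Rightarrow> nat \<Rightarrow> (nat \<Rightarrow>\<^sub>0 int) \<Rightarrow> nat set" where
  "Z_M n \<iota> i a = {k. 1 \<le> k \<and> \<iota> k = i \<and> sigma n \<iota> k a = Z_eps n \<iota> i a}"

text \<open>\<^const>\<open>Z_M\<close> is infinite when $\varepsilon_i = 0$, so its minimum is taken with \<^const>\<open>Least\<close>.\<close>
definition Z_crystal :: "nat \<Rightarrow> (nat \<Rightarrow> nat) \<Rightarrow> (nat \<Rightarrow>\<^sub>0 int) crystal" where
  "Z_crystal n \<iota> =
     \<lparr>elems = Z_inf,
      wt = Z_wt \<iota>,
      eps = Z_eps n \<iota>,
      phi = (\<lambda>i a. pairing n (simple_coroot i) (Z_wt \<iota> a) + Z_eps n \<iota> i a),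
      et = (\<lambda>i a. if Z_eps n \<iota> i a > 0
                   then Some (a - Poly_Mapping.single (Max (Z_M n \<iota> i a)) 1) else None),
      ft = (\<lambda>i a. Some (a + Poly_Mapping.single (LEAST k. k \<in> Z_M n \<iota> i a) 1))\<rparr>"

definition is_Psi :: "nat \<Rightarrow> (nat \<Rightarrow> nat) \<Rightarrow> (uq set \<Rightarrow> (nat \<Rightarrow>\<^sub>0 int)) \<Rightarrow> bool" where
  "is_Psi n \<iota> \<Psi> \<longleftrightarrow>
     strict_embedding {1..n} (B_inf_crystal n) (Z_crystal n \<iota>) \<Psi> \<and> \<Psi> (u_inf n) = 0"


section \<open>Linear forms and positivity\<close>

text \<open>The finite linear form $\sum_k c_k x_k$ is represented by its coefficients.\<close>
type_synonym form = "nat \<Rightarrow>\<^sub>0 rat"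

definition xform :: "nat \<Rightarrow> form" where
  "xform k = Poly_Mapping.single k 1"

definition apply_form :: "form \<Rightarrow> (nat \<Rightarrow>\<^sub>0 int) \<Rightarrow> rat" where
  "apply_form \<phi> a =
     (\<Sum>k\<in>Poly_Mapping.keys \<phi>. Poly_Mapping.lookup \<phi> k * of_int (Poly_Mapping.lookup a k))"

definition kplus :: "(nat \<Rightarrow> nat) \<Rightarrow> nat \<Rightarrow> nat" where
  "kplus \<iota> k = (LEAST l. k < l \<and> \<iota> l = \<iota> k)"

definition kminus :: "(nat \<Rightarrow> nat) \<Rightarrow> nat \<Rightarrow> nat" where
  "kminus \<iota> k = Max ({l. 1 \<le> l \<and> l < k \<and> \<iota> l = \<iota> k} \<union> {0})"

definition beta :: "nat \<Rightarrow> (nat \<Rightarrow> nat) \<Rightarrow> nat \<Rightarrow> form" where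
  "beta n \<iota> k =
     (if k = 0 then 0
      else xform k
           + (\<Sum>j\<in>{k<..<kplus \<iota> k}. Poly_Mapping.single j (of_int (cartan n (\<iota> k) (\<iota> j))))
           + xform (kplus \<iota> k))"

definition S' :: "nat \<Rightarrow> (nat \<Rightarrow> nat) \<Rightarrow> nat \<Rightarrow> form \<Rightarrow> form" where
  "S' n \<iota> k \<phi> =
     (if Poly_Mapping.lookup \<phi> k > 0 then \<phi> - beta n \<iota> k
      else if Poly_Mapping.lookup \<phi> k < 0 then \<phi> + beta n \<iota> (kminus \<iota> k)
      else \<phi>)"

inductive_set Xi' :: "nat \<Rightarrow> (nat \<Rightarrow> nat) \<Rightarrow> form set" for n \<iota> where
  base: "1 \<le> j \<Longrightarrow> xform j \<in> Xi' n \<iota>"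
| step: "\<phi> \<in> Xi' n \<iota> \<Longrightarrow> 1 \<le> j \<Longrightarrow> S' n \<iota> j \<phi> \<in> Xi' n \<iota>"

definition Xi'_positive :: "nat \<Rightarrow> (nat \<Rightarrow> nat) \<Rightarrow> bool" where
  "Xi'_positive n \<iota> \<longleftrightarrow>
     (\<forall>\<phi>\<in>Xi' n \<iota>. \<forall>k\<ge>1. kminus \<iota> k = 0 \<longrightarrow> Poly_Mapping.lookup \<phi> k \<ge> 0)"


section \<open>Extended Young diagrams\<close>

definition EYD :: "int \<Rightarrow> (nat \<Rightarrow> int) set" where
  "EYD k = {y. (\<forall>m. y m \<le> y (m + 1)) \<and> (\<exists>N. \<forall>m\<ge>N. y m = k)}"

definition convex_corners :: "(nat \<Rightarrow> int) \<Rightarrow> (int \<times> int) set" where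
  "convex_corners y = {(int m + 1, y m) | m. y m < y (m + 1)}"

definition concave_corners :: "(nat \<Rightarrow> int) \<Rightarrow> (int \<times> int) set" where
  "concave_corners y = {(0, y 0)} \<union> {(int m + 1, y (m + 1)) | m. y m < y (m + 1)}"

definition pi_idx :: "nat \<Rightarrow> int \<Rightarrow> nat" where
  "pi_idx n t =
     (let r = (t - 1) mod (2 * int n - 2) + 1
      in nat (if r \<le> int n then r else 2 * int n - r))"

function P_shift :: "nat \<Rightarrow> (nat \<Rightarrow> nat) \<Rightarrow> int \<Rightarrow> int \<Rightarrow> int" where
  "P_shift n \<iota> k t =
     (if t = k then 0
      else if t > k then P_shift n \<iota> k (t - 1) + p_idx \<iota> (pi_idx n t) (pi_idx n (t - 1))
      else P_shift n \<iota> k (t + 1) + p_idx \<iota> (pi_idx n t) (pi_idx n (t + 1)))"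
  by pat_completeness auto
termination
  by (relation "measure (\<lambda>(n, \<iota>, k, t). nat \<bar>t - k\<bar>)") auto

declare P_shift.simps [simp del]

text \<open>
  $x_{s,l}$, i.e. $x_j$ for the position $j$ of the $s$-th occurrence of $l$.
  The index $s$ is an integer because it is computed by integer arithmetic below;
  only $s \ge 1$ is meaningful.
\<close>
definition xdouble :: "(nat \<Rightarrow> nat) \<Rightarrow> int \<Rightarrow> nat \<Rightarrow> form" where
  "xdouble \<iota> s l =
     xform (THE j. 1 \<le> j \<and> \<iota> j = l \<and> int (card {m. 1 \<le> m \<and> m \<le> j \<and> \<iota> m = l}) = s)"

definition L_point :: "nat \<Rightarrow> (nat \<Rightarrow> nat) \<Rightarrow> int \<Rightarrow> int \<Rightarrow> int \<times> int \<Rightarrow> form" where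
  "L_point n \<iota> s k =
     (\<lambda>(i, j). xdouble \<iota> (s + P_shift n \<iota> k (i + j) + min (k - j) i) (pi_idx n (i + j)))"

definition L_form :: "nat \<Rightarrow> (nat \<Rightarrow> nat) \<Rightarrow> int \<Rightarrow> int \<Rightarrow> (nat \<Rightarrow> int) \<Rightarrow> form" where
  "L_form n \<iota> s k T =
     (\<Sum>P\<in>concave_corners T. L_point n \<iota> s k P) - (\<Sum>P\<in>convex_corners T. L_point n \<iota> s k P)"

end

theory Submission
  imports Defs
begin

text \<open>
  Since $\Psi_\iota$ is strict and every $\tilde f_i$ is total on $\mathbb Z^\infty$, its image
  is the set of all $\tilde f_{i_1}\cdots\tilde f_{i_l}\,0$. By summation by parts $L_{s,k,\iota}(T)$ is
  a sum over the columns of $T$, so lowering $y_i$ from $j$ to $j - 1$ changes it by a second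
  difference of $L_{s,k,\iota}$ over the unit square at $(i,j)$, which is $-\beta_m$ for
  $x_m = L_{s,k,\iota}(i,j)$. A coefficient $c_m > 0$ (resp. $c_m < 0$) of $L_{s,k,\iota}(T)$ comes from a
  concave (resp. convex) corner, where such a move (resp. its inverse) is possible.
  Hence the forms $L_{s,k,\iota}(T)$ contain all $x_m$ and are stable under the $S'_m$, and a negative
  coefficient never occurs at an $m$ with $m^{(-)} = 0$. As in the argument of Nakashima and
  Zelevinsky, iterating $S'_m$ shows that the cone of these forms is stable under
  $\tilde f_i$ and $\tilde e_i$, and in this cone every nonzero element can be lowered to $0$.
\<close>

section \<open>Adapted sequences\<close>

text \<open>Serves to recognise the occurrences of i and of j as the even and the odd places of
  their common subsequence.\<close>

lemma enumerate_unique: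
  fixes f :: "nat \<Rightarrow> nat"
  assumes mono: "strict_mono f" and T: "range f = T"
  shows "enumerate T = f"
proof
  have inf: "infinite T"
    using T range_inj_infinite strict_mono_imp_inj_on[OF mono] by blast
  fix m show "enumerate T m = f m"
  proof (induction m)
    case 0
    show ?case
      unfolding enumerate_0
      by (rule Least_equality) (use T in \<open>auto simp: strict_mono_less_eq[OF mono]\<close>)
  next
    case (Suc m)
    show ?case
      unfolding enumerate_Suc''[OF inf] Suc
      by (rule Least_equality)
        (use T in \<open>auto simp: strict_mono_less_eq[OF mono] strict_mono_less[OF mono]\<close>)
  qed
qed

lemma sum_pos_obtains:
  fixes f :: "'a \<Rightarrow> 'b::ordered_comm_monoid_add"
  assumes "0 < sum f A"
  obtains x where "x \<in> A" "\<not> f x \<le> 0"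
  using assms sum_nonpos[of A f] by (metis leD)

locale adapted_sequence =
  fixes n :: nat and \<iota> :: "nat \<Rightarrow> nat"
  assumes n_ge: "3 \<le> n" and seq: "index_sequence n \<iota>" and adapted: "adapted n \<iota>"
begin

section \<open>Occurrences of an index and their positions\<close>

definition occ :: "nat \<Rightarrow> nat set" where
  "occ l = {k. 1 \<le> k \<and> \<iota> k = l}"

text \<open>Double indices start at $s = 1$; smaller \<open>s\<close> give the first occurrence again.\<close>
definition pos :: "nat \<Rightarrow> int \<Rightarrow> nat" where
  "pos l s = enumerate (occ l) (nat (s - 1))"

lemma \<iota>_range: "1 \<le> k \<Longrightarrow> \<iota> k \<in> {1..n}"
  using seq unfolding index_sequence_def by blast

lemma infinite_occ: "l \<in> {1..n} \<Longrightarrow> infinite (occ l)"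
  using seq unfolding index_sequence_def occ_def by blast

lemma pos_ge_1: "l \<in> {1..n} \<Longrightarrow> 1 \<le> pos l s"
  and \<iota>_pos: "l \<in> {1..n} \<Longrightarrow> \<iota> (pos l s) = l"
  using enumerate_in_set[OF infinite_occ[of l]] unfolding pos_def occ_def by blast+

lemma pos_obtains:
  assumes "1 \<le> k" "\<iota> k = l"
  obtains s where "1 \<le> s" "k = pos l s"
proof -
  have "k \<in> occ l" using assms by (simp add: occ_def)
  then obtain m where "enumerate (occ l) m = k"
    using enumerate_Ex infinite_occ \<iota>_range assms by blast
  then show thesis
    by (intro that[of "int m + 1"]) (auto simp: pos_def)
qed

lemma pos_less_iff:
  "l \<in> {1..n} \<Longrightarrow> 1 \<le> s \<Longrightarrow> 1 \<le> s' \<Longrightarrow> pos l s < pos l s' \<longleftrightarrow> s < s'"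
  unfolding pos_def by (auto simp: enumerate_mono_iff[OF infinite_occ])

lemma pos_le_iff:
  "l \<in> {1..n} \<Longrightarrow> 1 \<le> s \<Longrightarrow> 1 \<le> s' \<Longrightarrow> pos l s \<le> pos l s' \<longleftrightarrow> s \<le> s'"
  unfolding pos_def by (auto simp: enumerate_mono_le_iff[OF infinite_occ])

lemma pos_eq_iff:
  "l \<in> {1..n} \<Longrightarrow> 1 \<le> s \<Longrightarrow> 1 \<le> s' \<Longrightarrow> pos l s = pos l s' \<longleftrightarrow> s = s'"
  by (metis pos_less_iff less_irrefl linorder_neqE)

text \<open>The occurrences of \<open>l\<close> up to \<open>pos l s\<close> are
  \<open>pos l 1\<close>, ..., \<open>pos l s\<close>. This makes \<open>pos l s\<close> the witness
  for the definite description in \<open>xdouble\<close>.\<close>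

lemma card_occ_le_pos:
  assumes l: "l \<in> {1..n}" and s: "1 \<le> s"
  shows "int (card {m. 1 \<le> m \<and> m \<le> pos l s \<and> \<iota> m = l}) = s"
proof -
  have "m \<in> pos l ` {1..s}" if m: "1 \<le> m" "m \<le> pos l s" "\<iota> m = l" for m
  proof -
    obtain s' where "1 \<le> s'" "m = pos l s'" using m by (blast elim: pos_obtains)
    then show ?thesis using m by (simp add: pos_le_iff[OF l _ s])
  qed
  moreover have "pos l ` {1..s} \<subseteq> {m. 1 \<le> m \<and> m \<le> pos l s \<and> \<iota> m = l}"
    using pos_ge_1[OF l] \<iota>_pos[OF l] pos_le_iff[OF l _ s] by auto
  ultimately have "{m. 1 \<le> m \<and> m \<le> pos l s \<and> \<iota> m = l} = pos l ` {1..s}"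
    by blast
  moreover have "inj_on (pos l) {1..s}"
    using pos_eq_iff[OF l] by (auto simp: inj_on_def)
  ultimately show ?thesis
    using s by (simp add: card_image)
qed

lemma xdouble_eq:
  assumes l: "l \<in> {1..n}" and s: "1 \<le> s"
  shows "xdouble \<iota> s l = xform (pos l s)"
  unfolding xdouble_def
proof (rule arg_cong[of _ _ xform], rule the_equality)
  show "1 \<le> pos l s \<and> \<iota> (pos l s) = l \<and>
      int (card {m. 1 \<le> m \<and> m \<le> pos l s \<and> \<iota> m = l}) = s"
    using pos_ge_1[OF l] \<iota>_pos[OF l] card_occ_le_pos[OF l s] by blast
next
  fix j assume j: "1 \<le> j \<and> \<iota> j = l \<and> int (card {m. 1 \<le> m \<and> m \<le> j \<and> \<iota> m = l}) = s"
  then obtain s' where "1 \<le> s'" "j = pos l s'"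
    by (blast elim: pos_obtains)
  then show "j = pos l s"
    using j card_occ_le_pos[OF l, of s'] by simp
qed

lemma kplus_pos:
  assumes l: "l \<in> {1..n}" and s: "1 \<le> s"
  shows "kplus \<iota> (pos l s) = pos l (s + 1)"
  unfolding kplus_def \<iota>_pos[OF l]
proof (rule Least_equality)
  show "pos l s < pos l (s + 1) \<and> \<iota> (pos l (s + 1)) = l"
    using s by (simp add: pos_less_iff[OF l] \<iota>_pos[OF l])
next
  fix k assume k: "pos l s < k \<and> \<iota> k = l"
  then obtain s' where "1 \<le> s'" "k = pos l s'"
    by (auto intro: pos_obtains[of k l])
  then show "pos l (s + 1) \<le> k"
    using k s by (simp add: pos_less_iff[OF l] pos_le_iff[OF l])
qed

lemma kminus_pos:
  assumes l: "l \<in> {1..n}" and s: "1 \<le> s"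
  shows "kminus \<iota> (pos l (s + 1)) = pos l s"
  unfolding kminus_def \<iota>_pos[OF l]
proof (rule Max_eqI)
  show "pos l s \<in> {j. 1 \<le> j \<and> j < pos l (s + 1) \<and> \<iota> j = l} \<union> {0}"
    using s pos_ge_1[OF l, of s] by (simp add: pos_less_iff[OF l] \<iota>_pos[OF l])
next
  fix k assume k: "k \<in> {j. 1 \<le> j \<and> j < pos l (s + 1) \<and> \<iota> j = l} \<union> {0}"
  show "k \<le> pos l s"
  proof (cases "k = 0")
    case False
    then obtain s' where "1 \<le> s'" "k = pos l s'"
      using k by (auto intro: pos_obtains[of k l])
    then show ?thesis
      using k s False by (auto simp: pos_less_iff[OF l] pos_le_iff[OF l])
  qed simp
qed simp

lemma kplus_kminus:
  assumes "1 \<le> k" "kminus \<iota> k \<noteq> 0"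
  shows "kplus \<iota> (kminus \<iota> k) = k" "kminus \<iota> k < k" "1 \<le> kminus \<iota> k" "\<iota> (kminus \<iota> k) = \<iota> k"
proof -
  obtain s where s: "1 \<le> s" "k = pos (\<iota> k) s" using assms(1) by (blast elim: pos_obtains)
  have l: "\<iota> k \<in> {1..n}" using \<iota>_range assms(1) by blast
  have "kminus \<iota> k \<in> {j. 1 \<le> j \<and> j < k \<and> \<iota> j = \<iota> k} \<union> {0}"
    unfolding kminus_def by (rule Max_in) auto
  then show *: "kminus \<iota> k < k" "1 \<le> kminus \<iota> k" "\<iota> (kminus \<iota> k) = \<iota> k"
    using assms by auto
  then obtain s' where "1 \<le> s'" "kminus \<iota> k = pos (\<iota> k) s'"
    by (blast elim: pos_obtains)
  \<comment> \<open>An earlier occurrence exists, so k is not the first one and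
    \<open>kminus_pos\<close> applies at s - 1.\<close>
  then have "s \<noteq> 1"
    using *(1) s pos_less_iff[OF l, of s' s] by auto
  then show "kplus \<iota> (kminus \<iota> k) = k"
    using s kminus_pos[OF l, of "s - 1"] kplus_pos[OF l, of "s - 1"] by simp
qed

text \<open>In the common subsequence, with ranks counted from 0, the i's have even and the j's odd
  rank, so \<open>pos i s\<close> and \<open>pos j s\<close> have ranks 2(s - 1) and 2(s - 1) + 1.
  Strictly between ranks a and a + 2 only rank a + 1 remains.\<close>

lemma interleaving:
  assumes i: "i \<in> {1..n}" and j: "j \<in> {1..n}" and "i \<noteq> j"
    and alt: "\<And>m. subseq2 \<iota> i j m = (if even m then i else j)" and s: "1 \<le> s"
  shows "{k \<in> {pos j s<..<pos j (s + 1)}. \<iota> k = i} = {pos i (s + 1)}"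
    and "{k \<in> {pos i s<..<pos i (s + 1)}. \<iota> k = j} = {pos j s}"
proof -
  define S where "S = {k. 1 \<le> k \<and> \<iota> k \<in> {i, j}}"
  have "occ i \<subseteq> S" by (auto simp: occ_def S_def)
  then have inf: "infinite S" using infinite_occ[OF i] finite_subset by blast
  have val: "\<iota> (enumerate S m) = (if even m then i else j)" for m
    using alt unfolding subseq2_def S_def by simp
  have S: "enumerate S m \<ge> 1" for m
    using enumerate_in_set[OF inf, of m] unfolding S_def by simp
  have ex: "\<exists>m. k = enumerate S m" if "1 \<le> k" "\<iota> k \<in> {i, j}" for k
    using enumerate_Ex[OF inf, of k] that by (auto simp: S_def)
  have "enumerate (occ i) = (\<lambda>m. enumerate S (2 * m))"
  proof (rule enumerate_unique)
    have "k \<in> range (\<lambda>m. enumerate S (2 * m))" if k: "k \<in> occ i" for k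
    proof -
      obtain m where m: "k = enumerate S m" using ex[of k] k by (auto simp: occ_def)
      then have "even m" using k val[of m] \<open>i \<noteq> j\<close> by (auto simp: occ_def split: if_splits)
      then show ?thesis using m by blast
    qed
    moreover have "enumerate S (2 * m) \<in> occ i" for m
      using S[of "2 * m"] val[of "2 * m"] by (simp add: occ_def)
    ultimately show "range (\<lambda>m. enumerate S (2 * m)) = occ i" by blast
  qed (auto simp: strict_mono_def inf)
  then have pos_i: "pos i s = enumerate S (2 * nat (s - 1))" for s by (simp add: pos_def)
  have "enumerate (occ j) = (\<lambda>m. enumerate S (2 * m + 1))"
  proof (rule enumerate_unique)
    have "k \<in> range (\<lambda>m. enumerate S (2 * m + 1))" if k: "k \<in> occ j" for k
    proof -
      obtain m where m: "k = enumerate S m" using ex[of k] k by (auto simp: occ_def)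
      then have "odd m" using k val[of m] \<open>i \<noteq> j\<close> by (auto simp: occ_def split: if_splits)
      then show ?thesis using m by (blast elim: oddE)
    qed
    moreover have "enumerate S (2 * m + 1) \<in> occ j" for m
      using S[of "2 * m + 1"] val[of "2 * m + 1"] by (simp add: occ_def)
    ultimately show "range (\<lambda>m. enumerate S (2 * m + 1)) = occ j" by blast
  qed (auto simp: strict_mono_def inf)
  then have pos_j: "pos j s = enumerate S (2 * nat (s - 1) + 1)" for s by (simp add: pos_def)
  obtain m where m: "nat (s - 1) = m" "nat (s + 1 - 1) = m + 1"
    using s by simp
  note mono = enumerate_mono_iff[OF inf]
  have between: "{k \<in> {enumerate S a<..<enumerate S (a + 2)}. \<iota> k \<in> {i, j}} = {enumerate S (a + 1)}"
    for a
  proof -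
    have "k = enumerate S (a + 1)"
      if k: "enumerate S a < k" "k < enumerate S (a + 2)" "\<iota> k \<in> {i, j}" for k
    proof -
      obtain b where b: "k = enumerate S b" using ex[of k] k by auto
      then have "b = a + 1" using k(1,2) by (simp add: mono)
      then show ?thesis using b by simp
    qed
    moreover have "\<iota> (enumerate S (a + 1)) \<in> {i, j}" by (simp add: val)
    ultimately show ?thesis by (auto simp: mono)
  qed
  have "{k \<in> {pos j s<..<pos j (s + 1)}. \<iota> k \<in> {i, j}} = {pos i (s + 1)}"
    using between[of "2 * m + 1"] unfolding pos_i pos_j m by simp
  moreover have "\<iota> (pos i (s + 1)) = i" by (rule \<iota>_pos[OF i])
  ultimately show "{k \<in> {pos j s<..<pos j (s + 1)}. \<iota> k = i} = {pos i (s + 1)}"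
    by blast
  have "{k \<in> {pos i s<..<pos i (s + 1)}. \<iota> k \<in> {i, j}} = {pos j s}"
    using between[of "2 * m"] unfolding pos_i pos_j m by simp
  moreover have "\<iota> (pos j s) = j" by (rule \<iota>_pos[OF j])
  ultimately show "{k \<in> {pos i s<..<pos i (s + 1)}. \<iota> k = j} = {pos j s}"
    by blast
qed

text \<open>\<open>p_idx \<iota> i j\<close> is 1 exactly when i opens the alternation. In that case
  the i after the s-th j is already the (s + 1)-st, otherwise it is the s-th, so one formula covers
  both orders.\<close>

lemma p_idx_neighbours:
  assumes i: "i \<in> {1..n}" and j: "j \<in> {1..n}" and neg: "cartan n i j < 0"
  shows "p_idx \<iota> i j + p_idx \<iota> j i = 1"
    and "1 \<le> s \<Longrightarrow>
      {k \<in> {pos j s<..<pos j (s + 1)}. \<iota> k = i} = {pos i (s + p_idx \<iota> i j)}"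
proof -
  have ne: "i \<noteq> j" using neg by (auto simp: cartan_def)
  have sym: "subseq2 \<iota> j i = subseq2 \<iota> i j"
    by (simp add: subseq2_def fun_eq_iff insert_commute)
  consider (1) "\<forall>m. subseq2 \<iota> i j m = (if even m then i else j)"
    | (2) "\<forall>m. subseq2 \<iota> j i m = (if even m then j else i)"
    using adapted i j neg unfolding adapted_def sym by blast
  then have "p_idx \<iota> i j + p_idx \<iota> j i = 1 \<and>
    (1 \<le> s \<longrightarrow> {k \<in> {pos j s<..<pos j (s + 1)}. \<iota> k = i} = {pos i (s + p_idx \<iota> i j)})"
  proof cases
    case 1
    then have "p_idx \<iota> i j = 1" by (simp add: p_idx_def)
    \<comment> \<open>The entry at 0 already tells the two alternations apart.\<close>
    moreover have "p_idx \<iota> j i = 0"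
      unfolding p_idx_def sym using 1[rule_format, of 0] ne by (auto intro!: exI[of _ 0])
    ultimately show ?thesis using interleaving(1)[OF i j ne] 1 by simp
  next
    case 2
    then have "p_idx \<iota> j i = 1" by (simp add: p_idx_def)
    moreover have "p_idx \<iota> i j = 0"
      unfolding p_idx_def sym[symmetric] using 2[rule_format, of 0] ne by (auto intro!: exI[of _ 0])
    ultimately show ?thesis using interleaving(2)[OF j i ne[symmetric]] 2 by simp
  qed
  then show "p_idx \<iota> i j + p_idx \<iota> j i = 1"
    and "1 \<le> s \<Longrightarrow>
      {k \<in> {pos j s<..<pos j (s + 1)}. \<iota> k = i} = {pos i (s + p_idx \<iota> i j)}"
    by blast+
qed

section \<open>The periodic walk on the index set\<close>

text \<open>The walk runs from 1 up to n and back, so at each time it ascends, descends or turns at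
  an end. At a turning point the values before and after coincide.\<close>

lemma pi_idx_cases:
  fixes t :: int
  obtains (asc) r where "1 < r" "r < n"
      "pi_idx n t = r" "pi_idx n (t + 1) = r + 1" "pi_idx n (t - 1) = r - 1"
  | (desc) r where "1 < r" "r < n"
      "pi_idx n t = r" "pi_idx n (t + 1) = r - 1" "pi_idx n (t - 1) = r + 1"
  | (first) "pi_idx n t = 1" "pi_idx n (t + 1) = 2" "pi_idx n (t - 1) = 2"
  | (last) "pi_idx n t = n" "pi_idx n (t + 1) = n - 1" "pi_idx n (t - 1) = n - 1"
proof -
  define N where "N = 2 * int n - 2"
  \<comment> \<open>The phase of the walk counted from 0: r = 0 is the end 1, and r = n - 1 is the
    end n.\<close>
  define r where "r = (t - 1) mod N"
  have N: "N > 2" using n_ge by (simp add: N_def)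
  then have r: "0 \<le> r" "r < N" by (auto simp: r_def)
  have nx: "(t + 1 - 1) mod N = (if r = N - 1 then 0 else r + 1)"
  proof -
    have "(t + 1 - 1) mod N = (r + 1) mod N"
      using mod_add_left_eq[of "t - 1" N 1] by (simp add: r_def)
    also have "\<dots> = (if r = N - 1 then 0 else r + 1)"
      using N r by (auto simp: mod_pos_pos_trivial)
    finally show ?thesis .
  qed
  have pv: "(t - 1 - 1) mod N = (if r = 0 then N - 1 else r - 1)"
  proof -
    have "(t - 1 - 1) mod N = (r - 1) mod N" by (simp add: r_def mod_diff_left_eq)
    also have "\<dots> = (if r = 0 then N - 1 else r - 1)"
      using N r by (auto simp: zmod_minus1 mod_pos_pos_trivial)
    finally show ?thesis .
  qed
  have pi: "pi_idx n u =
      nat (if (u - 1) mod N + 1 \<le> int n then (u - 1) mod N + 1 else 2 * int n - ((u - 1) mod N + 1))" for u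
    by (simp add: pi_idx_def N_def Let_def)
  note ev = pi[of t, folded r_def] pi[of "t + 1", unfolded nx] pi[of "t - 1", unfolded pv]
  consider "r = 0" | "r = int n - 1" | "0 < r" "r < int n - 1" | "int n - 1 < r"
    using r by atomize_elim linarith
  then show thesis
  proof cases
    case 1
    then have "pi_idx n t = 1" "pi_idx n (t + 1) = 2" "pi_idx n (t - 1) = 2"
      unfolding ev using n_ge by (simp_all add: N_def)
    then show ?thesis by (rule first)
  next
    case 2
    then have "pi_idx n t = n" "pi_idx n (t + 1) = n - 1" "pi_idx n (t - 1) = n - 1"
      unfolding ev using n_ge by (simp_all add: N_def)
    then show ?thesis by (rule last)
  next
    case 3
    define q where "q = nat (r + 1)"
    have q: "1 < q" "q < n" "r = int q - 1" using 3 by (auto simp: q_def)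
    then have "pi_idx n t = q" "pi_idx n (t + 1) = q + 1" "pi_idx n (t - 1) = q - 1"
      unfolding ev using n_ge by (simp_all add: N_def)
    then show ?thesis using q by (intro asc)
  next
    case 4
    define q where "q = nat (2 * int n - (r + 1))"
    have q: "1 < q" "q < n" "r = 2 * int n - int q - 1"
      using 4 r by (auto simp: q_def N_def)
    then have "pi_idx n t = q" "pi_idx n (t + 1) = q - 1" "pi_idx n (t - 1) = q + 1"
      unfolding ev using n_ge by (auto simp: N_def)
    then show ?thesis using q by (intro desc)
  qed
qed

lemma pi_idx_range: "pi_idx n t \<in> {1..n}"
  by (cases t rule: pi_idx_cases) (use n_ge in auto)

lemma pi_idx_self: "k \<in> {1..int n} \<Longrightarrow> pi_idx n k = nat k"
  using n_ge by (simp add: pi_idx_def mod_pos_pos_trivial)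

text \<open>At a turning point both indicators hold for the same r, which produces the entries -2 in
  rows 1 and n. In the interior the two neighbours are distinct and contribute -1 each.\<close>

lemma cartan_pi_idx:
  assumes r: "r \<in> {1..n}" "r \<noteq> pi_idx n t"
  shows "cartan n (pi_idx n t) r =
    - of_bool (r = pi_idx n (t - 1)) - of_bool (r = pi_idx n (t + 1))"
proof (cases t rule: pi_idx_cases)
  case (asc q)
  then show ?thesis using n_ge r unfolding asc by (auto simp: cartan_def)
next
  case (desc q)
  then show ?thesis using n_ge r unfolding desc by (auto simp: cartan_def)
next
  case first
  then show ?thesis using n_ge r unfolding first by (auto simp: cartan_def)
next
  case last
  then show ?thesis using n_ge r unfolding last by (auto simp: cartan_def)
qed

lemma cartan_pi_idx_neg:
  "cartan n (pi_idx n (t + 1)) (pi_idx n t) < 0" "cartan n (pi_idx n (t - 1)) (pi_idx n t) < 0"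
proof -
  have "cartan n (pi_idx n (t + 1)) (pi_idx n t) < 0 \<and> cartan n (pi_idx n (t - 1)) (pi_idx n t) < 0"
  proof (cases t rule: pi_idx_cases)
    case (asc q)
    then show ?thesis using n_ge unfolding asc by (auto simp: cartan_def)
  next
    case (desc q)
    then show ?thesis using n_ge unfolding desc by (auto simp: cartan_def)
  next
    case first
    then show ?thesis using n_ge unfolding first by (auto simp: cartan_def)
  next
    case last
    then show ?thesis using n_ge unfolding last by (auto simp: cartan_def)
  qed
  then show "cartan n (pi_idx n (t + 1)) (pi_idx n t) < 0" "cartan n (pi_idx n (t - 1)) (pi_idx n t) < 0"
    by blast+
qed

text \<open>By \<open>cartan_pi_idx\<close> only the neighbours of \<open>l\<close> on the walk
  contribute between two successive occurrences of \<open>l\<close>, and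
  \<open>p_idx_neighbours\<close> locates the single occurrence of each. At a turning point
  \<open>l1 = l2\<close>, and the same variable is subtracted twice.\<close>

lemma beta_pos:
  fixes t :: int
  assumes s: "1 \<le> s"
  defines "l \<equiv> pi_idx n t" and "l1 \<equiv> pi_idx n (t - 1)" and "l2 \<equiv> pi_idx n (t + 1)"
  shows "beta n \<iota> (pos l s) = xform (pos l s) + xform (pos l (s + 1))
    - xform (pos l1 (s + p_idx \<iota> l1 l)) - xform (pos l2 (s + p_idx \<iota> l2 l))"
proof -
  have rng: "l \<in> {1..n}" "l1 \<in> {1..n}" "l2 \<in> {1..n}"
    unfolding l_def l1_def l2_def by (rule pi_idx_range)+
  have neg: "cartan n l1 l < 0" "cartan n l2 l < 0"
    unfolding l_def l1_def l2_def by (rule cartan_pi_idx_neg)+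
  let ?A = "{pos l s<..<pos l (s + 1)}"
  have single: "(Poly_Mapping.single j (of_int (cartan n l (\<iota> j))) :: form) =
      - (if \<iota> j = l1 then xform j else 0) - (if \<iota> j = l2 then xform j else 0)"
    if j: "j \<in> ?A" for j
  proof -
    have "\<iota> j \<noteq> l"
      using j kplus_pos[OF rng(1) s] not_less_Least[of j "\<lambda>k. pos l s < k \<and> \<iota> k = l"]
      by (auto simp: kplus_def \<iota>_pos[OF rng(1)])
    moreover have "\<iota> j \<in> {1..n}" using j by (intro \<iota>_range) auto
    ultimately have "cartan n l (\<iota> j) = - of_bool (\<iota> j = l1) - of_bool (\<iota> j = l2)"
      unfolding l_def l1_def l2_def by (intro cartan_pi_idx)
    then show ?thesis
      by (simp add: xform_def single_diff single_uminus)
  qed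
  have filt: "(\<Sum>j\<in>?A. if \<iota> j = r then xform j else 0) = xform (pos r (s + p_idx \<iota> r l))"
    if "r \<in> {1..n}" "cartan n r l < 0" for r
    using p_idx_neighbours(2)[OF that(1) rng(1) that(2) s]
    by (subst sum.inter_filter[symmetric]) simp_all
  have "(\<Sum>j\<in>?A. Poly_Mapping.single j (of_int (cartan n l (\<iota> j))) :: form) =
      - xform (pos l1 (s + p_idx \<iota> l1 l)) - xform (pos l2 (s + p_idx \<iota> l2 l))"
    using filt[OF rng(2) neg(1)] filt[OF rng(3) neg(2)]
    by (simp add: single sum_subtractf sum_negf)
  then show ?thesis
    using pos_ge_1[OF rng(1), of s] kplus_pos[OF rng(1) s] \<iota>_pos[OF rng(1)]
    by (simp add: beta_def)
qed

end

section \<open>Moving corners of extended Young diagrams\<close>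

context adapted_sequence
begin

section \<open>Shifts and levels of lattice points\<close>

lemma p_idx_nonneg: "0 \<le> p_idx \<iota> i j"
  by (simp add: p_idx_def)

lemma P_shift_self [simp]: "P_shift n \<iota> k k = 0"
  by (subst P_shift.simps) simp

lemma P_shift_above:
  "k \<le> t \<Longrightarrow> P_shift n \<iota> k (t + 1) =
    P_shift n \<iota> k t + p_idx \<iota> (pi_idx n (t + 1)) (pi_idx n t)"
  by (subst P_shift.simps) simp

lemma P_shift_below:
  "t \<le> k \<Longrightarrow> P_shift n \<iota> k (t - 1) =
    P_shift n \<iota> k t + p_idx \<iota> (pi_idx n (t - 1)) (pi_idx n t)"
  by (subst P_shift.simps) simp

lemma P_shift_nonneg: "0 \<le> P_shift n \<iota> k t"
proof (cases "k \<le> t")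
  case True
  then show ?thesis
  proof (induction t rule: int_ge_induct)
    case (step t)
    then show ?case by (simp add: P_shift_above p_idx_nonneg)
  qed simp
next
  case False
  then have "t \<le> k" by simp
  then show ?thesis
  proof (induction t rule: int_le_induct)
    case (step t)
    then show ?case by (simp add: P_shift_below p_idx_nonneg)
  qed simp
qed

text \<open>The first index in \<open>L_point\<close>, isolated in order to follow it along the
  edges of a unit square.\<close>

definition level :: "int \<Rightarrow> int \<Rightarrow> int \<Rightarrow> int \<Rightarrow> int" where
  "level s k i j = s + P_shift n \<iota> k (i + j) + min (k - j) i"

text \<open>All corners lie in this region, so for s \<ge> 1 their first index is at least 1 and
  \<open>xdouble\<close> is meaningful there.\<close>

lemma level_ge: "0 \<le> i \<Longrightarrow> j \<le> k \<Longrightarrow> s \<le> level s k i j"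
  using P_shift_nonneg[of k "i + j"] by (simp add: level_def)

text \<open>The shift depends on i + j only, while both arguments of the minimum grow by
  one.\<close>

lemma level_diagonal: "level s k (i + 1) (j - 1) = level s k i j + 1"
  by (simp add: level_def min_def)

text \<open>For i + j \<ge> k the minimum stays at k - j and the shift grows by the stated amount.
  For i + j < k the minimum grows by one and the shift drops by \<open>p_idx\<close> with exchanged
  arguments; since the two values of \<open>p_idx\<close> add up to 1, the net change is the
  same.\<close>

lemma level_right:
  "level s k (i + 1) j = level s k i j + p_idx \<iota> (pi_idx n (i + j + 1)) (pi_idx n (i + j))"
proof (cases "k \<le> i + j")
  case True
  then show ?thesis using P_shift_above[OF True] by (simp add: level_def add_ac)
next
  case False
  then show ?thesis
    using P_shift_below[of "i + j + 1" k]
      p_idx_neighbours(1)[OF pi_idx_range pi_idx_range cartan_pi_idx_neg(1), of "i + j"]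
    by (simp add: level_def add_ac)
qed

text \<open>The same balance as in \<open>level_right\<close>, with the two sides of the line i + j
  = k exchanged.\<close>

lemma level_down:
  "level s k i (j - 1) = level s k i j + p_idx \<iota> (pi_idx n (i + j - 1)) (pi_idx n (i + j))"
proof (cases "i + j \<le> k")
  case True
  then show ?thesis using P_shift_below[OF True] by (simp add: level_def add_diff_eq)
next
  case False
  then show ?thesis
    using P_shift_above[of k "i + j - 1"]
      p_idx_neighbours(1)[OF pi_idx_range pi_idx_range cartan_pi_idx_neg(2), of "i + j"]
    by (simp add: level_def add_diff_eq)
qed

definition point :: "int \<Rightarrow> int \<Rightarrow> int \<Rightarrow> int \<Rightarrow> nat" where
  "point s k i j = pos (pi_idx n (i + j)) (level s k i j)"

lemma L_point_eq:
  "0 \<le> i \<Longrightarrow> j \<le> k \<Longrightarrow> 1 \<le> s \<Longrightarrow> L_point n \<iota> s k (i, j) = xform (point s k i j)"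
  unfolding L_point_def point_def using level_ge[of i j k s]
  by (simp add: xdouble_eq[OF pi_idx_range] level_def)

text \<open>The vertices (i, j) and (i + 1, j - 1) carry the same index at successive occurrences.
  The other two carry its neighbours on the walk, with exactly the occurrence numbers found in
  \<open>beta_pos\<close>.\<close>

lemma beta_point:
  assumes "0 \<le> i" "j \<le> k" "1 \<le> s"
  shows "beta n \<iota> (point s k i j) = L_point n \<iota> s k (i, j) + L_point n \<iota> s k (i + 1, j - 1)
    - L_point n \<iota> s k (i, j - 1) - L_point n \<iota> s k (i + 1, j)"
proof -
  have s: "1 \<le> level s k i j" using level_ge[OF assms(1,2), of s] assms(3) by linarith
  have "point s k (i + 1) (j - 1) = pos (pi_idx n (i + j)) (level s k i j + 1)"
    by (simp add: point_def level_diagonal)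
  moreover have "point s k i (j - 1) = pos (pi_idx n (i + j - 1))
      (level s k i j + p_idx \<iota> (pi_idx n (i + j - 1)) (pi_idx n (i + j)))"
    using level_down[of s k i j] by (simp add: point_def add_diff_eq)
  moreover have "point s k (i + 1) j = pos (pi_idx n (i + j + 1))
      (level s k i j + p_idx \<iota> (pi_idx n (i + j + 1)) (pi_idx n (i + j)))"
    using level_right[of s k i j] by (simp add: point_def add_ac)
  ultimately show ?thesis
    using assms by (simp add: L_point_eq) (simp add: point_def beta_pos[OF s])
qed

lemma EYD_le: "y \<in> EYD k \<Longrightarrow> y m \<le> k"
proof -
  assume y: "y \<in> EYD k"
  then have "mono y" by (simp add: EYD_def mono_iff_le_Suc)
  moreover obtain N where "\<forall>m\<ge>N. y m = k" using y unfolding EYD_def by blast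
  ultimately show "y m \<le> k" using monoD[of y m "max m N"] by simp
qed

text \<open>
  Every column $m$ with $y_m < y_{m+1}$ yields two corners, and for the other columns the two
  terms would cancel; regrouping the sum by the value $y_m$ leaves a sum in which each term
  depends on one $y_m$ only.
\<close>
lemma L_form_sum:
  assumes y: "y \<in> EYD k" and N: "\<And>m. N \<le> m \<Longrightarrow> y m = k"
  shows "L_form n \<iota> s k y =
    (\<Sum>m<N. L_point n \<iota> s k (int m, y m) - L_point n \<iota> s k (int m + 1, y m))
    + L_point n \<iota> s k (int N, k)"
proof -
  let ?L = "\<lambda>i j. L_point n \<iota> s k (i, j)"
  let ?J = "{m \<in> {..<N}. y m < y (m + 1)}"
  have "m < N" if "y m < y (m + 1)" for m
    using that N[of m] N[of "m + 1"] by (cases "m < N") auto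
  then have J: "{m. y m < y (m + 1)} = ?J" by auto
  have "concave_corners y = insert (0, y 0) ((\<lambda>m. (int m + 1, y (m + 1))) ` ?J)"
    unfolding concave_corners_def J[symmetric] by auto
  moreover have "(0, y 0) \<notin> (\<lambda>m. (int m + 1, y (m + 1))) ` ?J" by auto
  ultimately have concave: "(\<Sum>P\<in>concave_corners y. L_point n \<iota> s k P) =
      ?L 0 (y 0) + (\<Sum>m\<in>?J. ?L (int m + 1) (y (m + 1)))"
    by (simp add: sum.reindex inj_on_def)
  have "convex_corners y = (\<lambda>m. (int m + 1, y m)) ` ?J"
    unfolding convex_corners_def J[symmetric] by auto
  then have convex: "(\<Sum>P\<in>convex_corners y. L_point n \<iota> s k P) = (\<Sum>m\<in>?J. ?L (int m + 1) (y m))"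
    by (simp add: sum.reindex inj_on_def)
  have "L_form n \<iota> s k y = ?L 0 (y 0) + (\<Sum>m\<in>?J. ?L (int m + 1) (y (m + 1)) - ?L (int m + 1) (y m))"
    unfolding L_form_def concave convex by (simp add: sum_subtractf)
  also have "(\<Sum>m\<in>?J. ?L (int m + 1) (y (m + 1)) - ?L (int m + 1) (y m)) =
      (\<Sum>m<N. ?L (int m + 1) (y (m + 1)) - ?L (int m + 1) (y m))"
  proof (rule sum.mono_neutral_left)
    show "\<forall>m\<in>{..<N} - ?J. ?L (int m + 1) (y (m + 1)) - ?L (int m + 1) (y m) = 0"
    proof
      fix m assume "m \<in> {..<N} - ?J"
      then have "y (m + 1) = y m" using y by (auto simp: EYD_def intro: antisym)
      then show "?L (int m + 1) (y (m + 1)) - ?L (int m + 1) (y m) = 0" by simp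
    qed
  qed auto
  \<comment> \<open>Inserting the value at (m, y_m) splits off a telescoping sum, whose lower end
    cancels the corner (0, y_0).\<close>
  also have "\<dots> = (\<Sum>m<N. ?L (int m) (y m) - ?L (int m + 1) (y m))
      + (\<Sum>m<N. ?L (int (Suc m)) (y (Suc m)) - ?L (int m) (y m))"
    by (simp add: sum.distrib[symmetric] add.commute)
  also have "(\<Sum>m<N. ?L (int (Suc m)) (y (Suc m)) - ?L (int m) (y m)) = ?L (int N) k - ?L 0 (y 0)"
    using sum_lessThan_telescope[of "\<lambda>m. ?L (int m) (y m)" N] N by simp
  finally show ?thesis by simp
qed

lemma EYD_upd:
  assumes y: "y \<in> EYD k" and low: "m = 0 \<or> y (m - 1) \<le> v" and up: "v \<le> y (m + 1)"
  shows "y(m := v) \<in> EYD k"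
proof -
  obtain N where N: "\<forall>q\<ge>N. y q = k" using y unfolding EYD_def by blast
  have "(y(m := v)) q \<le> (y(m := v)) (q + 1)" for q
    using y low up unfolding EYD_def by auto
  moreover have "\<forall>q\<ge>max N (m + 1). (y(m := v)) q = k" using N by simp
  ultimately show ?thesis unfolding EYD_def by blast
qed

text \<open>In \<open>L_form_sum\<close> only the m-th term involves \<open>y m\<close>; everything
  else is common to the two diagrams.\<close>

lemma L_form_upd:
  assumes y: "y \<in> EYD k" and y': "y(m := v) \<in> EYD k"
  shows "L_form n \<iota> s k (y(m := v)) = L_form n \<iota> s k y
    + (L_point n \<iota> s k (int m, v) - L_point n \<iota> s k (int m + 1, v))
    - (L_point n \<iota> s k (int m, y m) - L_point n \<iota> s k (int m + 1, y m))"
proof -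
  obtain N where "\<And>q. N \<le> q \<Longrightarrow> y q = k" using y unfolding EYD_def by blast
  \<comment> \<open>A common cut-off: both diagrams are constant beyond it, and column m lies inside
    the sum.\<close>
  then have N: "\<And>q. max N (m + 1) \<le> q \<Longrightarrow> y q = k" "\<And>q. max N (m + 1) \<le> q \<Longrightarrow> (y(m := v)) q = k"
    by simp_all
  let ?K = "max N (m + 1)"
  let ?A = "\<lambda>q j. L_point n \<iota> s k (int q, j) - L_point n \<iota> s k (int q + 1, j)"
  have m: "m \<in> {..<?K}" by simp
  have "(\<Sum>q<?K. ?A q ((y(m := v)) q)) = ?A m v + (\<Sum>q\<in>{..<?K} - {m}. ?A q (y q))"
    using m by (subst sum.remove[of _ m]) (auto intro!: sum.cong)
  moreover have "(\<Sum>q<?K. ?A q (y q)) = ?A m (y m) + (\<Sum>q\<in>{..<?K} - {m}. ?A q (y q))"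
    using m by (subst sum.remove[of _ m]) auto
  moreover have "L_form n \<iota> s k y = (\<Sum>q<?K. ?A q (y q)) + L_point n \<iota> s k (int ?K, k)"
    by (rule L_form_sum[OF y]) (rule N)
  moreover have "L_form n \<iota> s k (y(m := v)) =
      (\<Sum>q<?K. ?A q ((y(m := v)) q)) + L_point n \<iota> s k (int ?K, k)"
    by (rule L_form_sum[OF y']) (rule N)
  ultimately show ?thesis by (simp only:) simp
qed

section \<open>Closure of the forms under the operators \<open>S'\<close>\<close>

definition forms :: "form set" where
  "forms = {L_form n \<iota> s k T | s k T. k \<in> {1..int n} \<and> 1 \<le> s \<and> T \<in> EYD k}"

lemma formsI: "k \<in> {1..int n} \<Longrightarrow> 1 \<le> s \<Longrightarrow> T \<in> EYD k \<Longrightarrow> L_form n \<iota> s k T = \<phi> \<Longrightarrow> \<phi> \<in> forms"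
  unfolding forms_def by blast

text \<open>A constant diagram has the single corner (0, k) and the form x_{s,k}; k = \<iota> j and
  the occurrence number s of j give x_j.\<close>

lemma xform_in_forms:
  assumes "1 \<le> j"
  shows "xform j \<in> forms"
proof -
  obtain s where s: "1 \<le> s" "j = pos (\<iota> j) s" using assms by (blast elim: pos_obtains)
  let ?k = "int (\<iota> j)"
  have k: "?k \<in> {1..int n}" using \<iota>_range[OF assms] by simp
  have T: "(\<lambda>_. ?k) \<in> EYD ?k" by (simp add: EYD_def)
  have "L_form n \<iota> s ?k (\<lambda>_. ?k) = L_point n \<iota> s ?k (0, ?k)"
    by (simp add: L_form_def concave_corners_def convex_corners_def)
  also have "\<dots> = xform j"
    using s k by (simp add: L_point_eq point_def level_def pi_idx_self)
  finally show ?thesis by (rule formsI[OF k s(1) T])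
qed

lemma lookup_L_form:
  "Poly_Mapping.lookup (L_form n \<iota> s k T) j =
    (\<Sum>P\<in>concave_corners T. Poly_Mapping.lookup (L_point n \<iota> s k P) j)
    - (\<Sum>P\<in>convex_corners T. Poly_Mapping.lookup (L_point n \<iota> s k P) j)"
  by (simp add: L_form_def lookup_minus lookup_sum)

lemma lookup_xform: "Poly_Mapping.lookup (xform k) j = (if k = j then 1 else 0)"
  by (simp add: xform_def lookup_single)

lemma lookup_L_point:
  "Poly_Mapping.lookup (L_point n \<iota> s k P) j \<in> {0, 1}"
  by (cases P) (auto simp: L_point_def xdouble_def lookup_xform)

text \<open>Integrality allows a coefficient to be brought to 0 by finitely many unit steps.\<close>

lemma lookup_forms_Ints: "\<phi> \<in> forms \<Longrightarrow> Poly_Mapping.lookup \<phi> j \<in> \<int>"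
proof -
  have "Poly_Mapping.lookup (L_point n \<iota> s k P) j \<in> \<int>" for s k P
    using lookup_L_point[of s k P j] by auto
  then show "\<phi> \<in> forms \<Longrightarrow> Poly_Mapping.lookup \<phi> j \<in> \<int>"
    unfolding forms_def by (auto simp: lookup_L_form intro!: Ints_diff Ints_sum)
qed

lemma sum_L_point_nonneg: "0 \<le> (\<Sum>P\<in>A. Poly_Mapping.lookup (L_point n \<iota> s k P) j)"
proof (rule sum_nonneg)
  show "0 \<le> Poly_Mapping.lookup (L_point n \<iota> s k P) j" for P
    using lookup_L_point[of s k P j] by auto
qed

text \<open>A positive coefficient needs a concave corner (m, y_m) on the variable x_j. There m = 0
  or y_(m-1) < y_m, so lowering y_m by one gives a diagram again, and by \<open>beta_point\<close>
  the form changes by -\<beta>_j.\<close>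

lemma forms_minus_beta:
  assumes "\<phi> \<in> forms" and pos: "0 < Poly_Mapping.lookup \<phi> j"
  shows "\<phi> - beta n \<iota> j \<in> forms"
proof -
  obtain s k y where \<phi>: "\<phi> = L_form n \<iota> s k y" and k: "k \<in> {1..int n}" and s: "1 \<le> s"
    and y: "y \<in> EYD k"
    using assms(1) unfolding forms_def by blast
  have "0 < (\<Sum>P\<in>concave_corners y. Poly_Mapping.lookup (L_point n \<iota> s k P) j)"
    using pos sum_L_point_nonneg[of s k j "convex_corners y"] unfolding \<phi> lookup_L_form by linarith
  then obtain P where "P \<in> concave_corners y" and P: "\<not> Poly_Mapping.lookup (L_point n \<iota> s k P) j \<le> 0"
    by (rule sum_pos_obtains)
  obtain m where m: "P = (int m, y m)" "m = 0 \<or> y (m - 1) < y m"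
  proof (cases "P = (0, y 0)")
    case True
    then show thesis by (intro that[of 0]) simp_all
  next
    case False
    then obtain q where "P = (int q + 1, y (q + 1))" "y q < y (q + 1)"
      using \<open>P \<in> concave_corners y\<close> unfolding concave_corners_def by blast
    then show thesis by (intro that[of "q + 1"]) simp_all
  qed
  have le: "y m \<le> k" by (rule EYD_le[OF y])
  have j: "j = point s k (int m) (y m)"
    using P s le unfolding m by (simp add: L_point_eq lookup_xform split: if_splits)
  let ?y = "y(m := y m - 1)"
  have y': "?y \<in> EYD k"
  proof (rule EYD_upd[OF y])
    have "y m \<le> y (m + 1)" using y unfolding EYD_def by blast
    then show "y m - 1 \<le> y (m + 1)" by linarith
  qed (use m(2) in auto)
  show ?thesis
  proof (rule formsI[OF k s y'])
    show "L_form n \<iota> s k ?y = \<phi> - beta n \<iota> j"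
      unfolding \<phi> j L_form_upd[OF y y'] using s le by (subst beta_point) simp_all
  qed
qed

text \<open>A negative coefficient needs a convex corner (m + 1, y_m), where y_m can be raised by
  one. The opposite vertex (m, y_m + 1) of the square lies on the same diagonal one level lower, so
  it is the previous occurrence, which therefore exists.\<close>

lemma forms_plus_beta:
  assumes "\<phi> \<in> forms" and neg: "Poly_Mapping.lookup \<phi> j < 0"
  shows "kminus \<iota> j \<noteq> 0" and "\<phi> + beta n \<iota> (kminus \<iota> j) \<in> forms"
proof -
  obtain s k y where \<phi>: "\<phi> = L_form n \<iota> s k y" and k: "k \<in> {1..int n}" and s: "1 \<le> s"
    and y: "y \<in> EYD k"
    using assms(1) unfolding forms_def by blast
  have "0 < (\<Sum>P\<in>convex_corners y. Poly_Mapping.lookup (L_point n \<iota> s k P) j)"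
    using neg sum_L_point_nonneg[of s k j "concave_corners y"] unfolding \<phi> lookup_L_form by linarith
  then obtain P where "P \<in> convex_corners y" and P: "\<not> Poly_Mapping.lookup (L_point n \<iota> s k P) j \<le> 0"
    by (rule sum_pos_obtains)
  then obtain m where m: "P = (int m + 1, y m)" "y m < y (m + 1)"
    unfolding convex_corners_def by blast
  have le: "y m + 1 \<le> k" using m(2) EYD_le[OF y, of "m + 1"] by simp
  let ?l = "pi_idx n (int m + (y m + 1))" and ?a = "level s k (int m) (y m + 1)"
  have a: "1 \<le> ?a" using level_ge[of "int m" "y m + 1" k s] s le by simp
  have "j = point s k (int m + 1) (y m)"
    using P s le unfolding m by (simp add: L_point_eq lookup_xform split: if_splits)
  also have "\<dots> = pos ?l (?a + 1)"
    using level_diagonal[of s k "int m" "y m + 1"] by (simp add: point_def add_ac)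
  finally have kminus: "kminus \<iota> j = point s k (int m) (y m + 1)"
    using kminus_pos[OF pi_idx_range a] by (simp add: point_def)
  then show "kminus \<iota> j \<noteq> 0"
    using pos_ge_1[OF pi_idx_range, of "int m + (y m + 1)" ?a] by (simp add: point_def)
  let ?y = "y(m := y m + 1)"
  have y': "?y \<in> EYD k"
  proof (rule EYD_upd[OF y])
    have "y (m - 1) \<le> y (m - 1 + 1)" using y unfolding EYD_def by blast
    then show "m = 0 \<or> y (m - 1) \<le> y m + 1" by (cases m) auto
  qed (use m(2) le in auto)
  show "\<phi> + beta n \<iota> (kminus \<iota> j) \<in> forms"
  proof (rule formsI[OF k s y'])
    show "L_form n \<iota> s k ?y = \<phi> + beta n \<iota> (kminus \<iota> j)"
      unfolding \<phi> kminus L_form_upd[OF y y'] using s le by (subst beta_point) simp_all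
  qed
qed

lemma Xi'_subset_forms: "\<phi> \<in> Xi' n \<iota> \<Longrightarrow> \<phi> \<in> forms"
proof (induction rule: Xi'.induct)
  case (step \<phi> j)
  then show ?case by (simp add: S'_def forms_minus_beta forms_plus_beta)
qed (rule xform_in_forms)

lemma Xi'_positive: "Xi'_positive n \<iota>"
  unfolding Xi'_positive_def using forms_plus_beta(1)[OF Xi'_subset_forms] by (meson not_less)

end

section \<open>The cone and the crystal operators\<close>

lemma apply_form_superset:
  assumes "finite A" "Poly_Mapping.keys \<phi> \<subseteq> A"
  shows "apply_form \<phi> a = (\<Sum>k\<in>A. Poly_Mapping.lookup \<phi> k * of_int (Poly_Mapping.lookup a k))"
  unfolding apply_form_def
  by (rule sum.mono_neutral_left) (use assms in \<open>auto simp: in_keys_iff\<close>)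

lemma apply_form_add: "apply_form (\<phi> + \<psi>) a = apply_form \<phi> a + apply_form \<psi> a"
proof -
  let ?A = "Poly_Mapping.keys \<phi> \<union> Poly_Mapping.keys \<psi>"
  have "Poly_Mapping.keys (\<phi> + \<psi>) \<subseteq> ?A" by (rule Poly_Mapping.keys_add)
  then show ?thesis
    by (simp add: apply_form_superset[of ?A] lookup_add distrib_right sum.distrib)
qed

lemma apply_form_zero [simp]: "apply_form 0 a = 0"
  by (simp add: apply_form_def)

lemma apply_form_diff: "apply_form (\<phi> - \<psi>) a = apply_form \<phi> a - apply_form \<psi> a"
  using apply_form_add[of "\<phi> - \<psi>" \<psi> a] by simp

lemma apply_form_sum: "apply_form (sum f A) a = (\<Sum>j\<in>A. apply_form (f j) a)"
  by (induction A rule: infinite_finite_induct) (simp_all add: apply_form_add)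

lemma apply_form_single:
  "apply_form (Poly_Mapping.single k c) a = c * of_int (Poly_Mapping.lookup a k)"
  by (simp add: apply_form_superset[of "{k}"])

lemma apply_form_add_single:
  "apply_form \<phi> (a + Poly_Mapping.single k c) = apply_form \<phi> a + Poly_Mapping.lookup \<phi> k * of_int c"
proof -
  let ?A = "insert k (Poly_Mapping.keys \<phi>)"
  have "(\<Sum>j\<in>?A. Poly_Mapping.lookup \<phi> j * of_int (Poly_Mapping.lookup (Poly_Mapping.single k c) j))
      = (\<Sum>j\<in>?A. if j = k then Poly_Mapping.lookup \<phi> k * of_int c else 0)"
    by (rule sum.cong) (auto simp: lookup_single)
  also have "\<dots> = Poly_Mapping.lookup \<phi> k * of_int c"
    by (subst sum.delta) simp_all
  finally show ?thesis
    by (simp add: apply_form_superset[of ?A, OF _ subset_insertI] lookup_add distrib_left sum.distrib)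
qed

text \<open>An interval in place of the support lets the sums for two sequences or two positions be
  compared term by term.\<close>

lemma sigma_bounded:
  assumes "Poly_Mapping.keys a \<subseteq> {..<M}"
  shows "sigma n \<iota> k a = Poly_Mapping.lookup a k +
    (\<Sum>j\<in>{k<..<M}. cartan n (\<iota> k) (\<iota> j) * Poly_Mapping.lookup a j)"
  unfolding sigma_def
  by (subst sum.mono_neutral_left[of "{k<..<M}"]) (use assms in \<open>auto simp: in_keys_iff\<close>)

lemma keys_bounded_obtains:
  fixes a :: "nat \<Rightarrow>\<^sub>0 int"
  obtains M where "Poly_Mapping.keys a \<subseteq> {..<M}" "k < M"
proof -
  obtain M where "\<forall>j\<in>insert k (Poly_Mapping.keys a). j < M"
    using finite_nat_set_iff_bounded[of "insert k (Poly_Mapping.keys a)"] by auto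
  then show thesis by (intro that[of M]) auto
qed

lemma sigma_add_single:
  "sigma n \<iota> j (a + Poly_Mapping.single k c) =
    sigma n \<iota> j a + (if j = k then c else if j < k then cartan n (\<iota> j) (\<iota> k) * c else 0)"
proof -
  obtain M where M: "Poly_Mapping.keys a \<subseteq> {..<M}" "k < M" by (rule keys_bounded_obtains)
  have M': "Poly_Mapping.keys (a + Poly_Mapping.single k c) \<subseteq> {..<M}"
    using M Poly_Mapping.keys_add[of a "Poly_Mapping.single k c"] by (fastforce split: if_splits)
  have "(\<Sum>q\<in>{j<..<M}. cartan n (\<iota> j) (\<iota> q) * Poly_Mapping.lookup (Poly_Mapping.single k c) q) =
      (\<Sum>q\<in>{j<..<M}. if q = k then cartan n (\<iota> j) (\<iota> k) * c else 0)"
    by (rule sum.cong) (auto simp: lookup_single)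
  also have "\<dots> = (if j < k then cartan n (\<iota> j) (\<iota> k) * c else 0)"
    using M(2) by (subst sum.delta) auto
  finally show ?thesis
    unfolding sigma_bounded[OF M(1)] sigma_bounded[OF M']
    by (auto simp: lookup_add lookup_single distrib_left sum.distrib)
qed

context adapted_sequence
begin

lemma kplus_props:
  assumes "1 \<le> k"
  shows "k < kplus \<iota> k" "\<iota> (kplus \<iota> k) = \<iota> k"
proof -
  obtain s where s: "1 \<le> s" "k = pos (\<iota> k) s" using assms by (blast elim: pos_obtains)
  have l: "\<iota> k \<in> {1..n}" by (rule \<iota>_range[OF assms])
  have "kplus \<iota> k = pos (\<iota> k) (s + 1)" using kplus_pos[OF l s(1)] s(2) by simp
  then show "k < kplus \<iota> k" "\<iota> (kplus \<iota> k) = \<iota> k"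
    using s pos_less_iff[OF l s(1), of "s + 1"] \<iota>_pos[OF l] by simp_all
qed

lemma lookup_beta:
  assumes "1 \<le> k"
  shows "Poly_Mapping.lookup (beta n \<iota> k) k = 1"
    and "Poly_Mapping.lookup (beta n \<iota> k) (kplus \<iota> k) = 1"
  using kplus_props(1)[OF assms] assms
  by (auto simp: beta_def lookup_add lookup_sum lookup_xform lookup_single intro!: sum.neutral)

text \<open>Both positions carry the same index, so the tails beyond \<open>kplus \<iota> k\<close>
  cancel. At \<open>kplus \<iota> k\<close> itself the diagonal entry 2 minus 1 leaves the
  coefficient 1.\<close>

lemma apply_beta:
  assumes k: "1 \<le> k"
  shows "apply_form (beta n \<iota> k) a = of_int (sigma n \<iota> k a - sigma n \<iota> (kplus \<iota> k) a)"
proof -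
  let ?k' = "kplus \<iota> k"
  let ?c = "\<lambda>j. cartan n (\<iota> k) (\<iota> j) * Poly_Mapping.lookup a j"
  obtain M where M: "Poly_Mapping.keys a \<subseteq> {..<M}" "?k' < M" by (rule keys_bounded_obtains)
  note k' = kplus_props[OF k]
  have "{k<..<M} = {k<..<?k'} \<union> insert ?k' {?k'<..<M}" using M(2) k'(1) by auto
  moreover have "{k<..<?k'} \<inter> insert ?k' {?k'<..<M} = {}" by auto
  ultimately have "(\<Sum>j\<in>{k<..<M}. ?c j) = (\<Sum>j\<in>{k<..<?k'}. ?c j) + (?c ?k' + (\<Sum>j\<in>{?k'<..<M}. ?c j))"
    by (simp add: sum.union_disjoint)
  moreover have "?c ?k' = 2 * Poly_Mapping.lookup a ?k'" by (simp add: k'(2) cartan_def)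
  ultimately show ?thesis
    using k unfolding sigma_bounded[OF M(1)]
    by (simp add: beta_def apply_form_add apply_form_sum apply_form_single xform_def k'(2))
qed

text \<open>Beyond the support \<sigma> vanishes, so it takes finitely many values and the
  \<open>Max\<close> in \<open>Z_eps\<close> is attained although it ranges over infinitely many
  positions.\<close>

lemma sigma_image_finite: "finite ((\<lambda>k. sigma n \<iota> k a) ` A)"
  and sigma_eventually_0: "\<exists>M. \<forall>k\<ge>M. sigma n \<iota> k a = 0"
proof -
  obtain M where M: "Poly_Mapping.keys a \<subseteq> {..<M}" by (rule keys_bounded_obtains)
  have *: "sigma n \<iota> k a = 0" if "M \<le> k" for k
  proof -
    have "k \<notin> Poly_Mapping.keys a" using M that by auto
    then show ?thesis using that by (simp add: sigma_bounded[OF M] in_keys_iff)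
  qed
  then show "\<exists>M. \<forall>k\<ge>M. sigma n \<iota> k a = 0" by blast
  have "(\<lambda>k. sigma n \<iota> k a) ` A \<subseteq> insert 0 ((\<lambda>k. sigma n \<iota> k a) ` {..<M})"
    using * by (force simp: not_le[symmetric])
  then show "finite ((\<lambda>k. sigma n \<iota> k a) ` A)" by (rule finite_subset) simp
qed

lemma sigma_le_eps: "1 \<le> k \<Longrightarrow> \<iota> k = i \<Longrightarrow> sigma n \<iota> k a \<le> Z_eps n \<iota> i a"
  unfolding Z_eps_def by (intro Max_ge sigma_image_finite) auto

lemma Z_M_nonempty:
  assumes "i \<in> {1..n}"
  obtains k where "k \<in> Z_M n \<iota> i a"
proof -
  have "{k. 1 \<le> k \<and> \<iota> k = i} \<noteq> {}" using infinite_occ[OF assms] unfolding occ_def by (metis finite.emptyI)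
  then have "Z_eps n \<iota> i a \<in> (\<lambda>k. sigma n \<iota> k a) ` {k. 1 \<le> k \<and> \<iota> k = i}"
    unfolding Z_eps_def by (intro Max_in sigma_image_finite) auto
  then show thesis by (auto simp: Z_M_def intro: that)
qed

lemma Z_M_finite:
  assumes "0 < Z_eps n \<iota> i a"
  shows "finite (Z_M n \<iota> i a)"
proof -
  obtain M where "\<forall>k\<ge>M. sigma n \<iota> k a = 0" using sigma_eventually_0 by blast
  then have "Z_M n \<iota> i a \<subseteq> {..<M}"
    using assms unfolding Z_M_def by (auto simp: not_le[symmetric])
  then show ?thesis by (rule finite_subset) simp
qed

section \<open>Stability of the cone under the crystal operators\<close>

text \<open>The right-hand side of the theorem, with the quantifiers over k, s and T gathered in
  \<open>forms\<close>.\<close>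

definition cone :: "(nat \<Rightarrow>\<^sub>0 int) set" where
  "cone = {a \<in> Z_inf. \<forall>\<phi>\<in>forms. 0 \<le> apply_form \<phi> a}"

text \<open>Since \<beta>_k has coefficient 1 at k, subtracting it m times stays in
  \<open>forms\<close> and ends with a form that is nonnegative on the cone.\<close>

lemma form_ge_beta:
  assumes "a \<in> cone" "1 \<le> k" "\<phi> \<in> forms" "Poly_Mapping.lookup \<phi> k = of_nat m"
  shows "of_nat m * apply_form (beta n \<iota> k) a \<le> apply_form \<phi> a"
  using assms(3,4)
proof (induction m arbitrary: \<phi>)
  case 0
  then show ?case using assms(1) by (simp add: cone_def)
next
  case (Suc m)
  have "\<phi> - beta n \<iota> k \<in> forms" using Suc.prems by (intro forms_minus_beta) simp_all
  moreover have "Poly_Mapping.lookup (\<phi> - beta n \<iota> k) k = of_nat m"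
    using Suc.prems lookup_beta(1)[OF assms(2)] by (simp add: lookup_minus)
  ultimately have "of_nat m * apply_form (beta n \<iota> k) a \<le> apply_form (\<phi> - beta n \<iota> k) a"
    by (rule Suc.IH)
  then show ?case by (simp add: apply_form_diff algebra_simps)
qed

text \<open>The mirror image: the upper end of \<open>beta n \<iota> (kminus \<iota> k)\<close> is
  k, again with coefficient 1, so m additions bring the coefficient -m to 0.\<close>

lemma form_ge_beta_kminus:
  assumes "a \<in> cone" "1 \<le> k" "\<phi> \<in> forms" "Poly_Mapping.lookup \<phi> k = - of_nat m"
  shows "- (of_nat m * apply_form (beta n \<iota> (kminus \<iota> k)) a) \<le> apply_form \<phi> a"
  using assms(3,4)
proof (induction m arbitrary: \<phi>)
  case 0
  then show ?case using assms(1) by (simp add: cone_def)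
next
  case (Suc m)
  let ?b = "beta n \<iota> (kminus \<iota> k)"
  have neg: "Poly_Mapping.lookup \<phi> k < 0" using Suc.prems by simp
  have "\<phi> + ?b \<in> forms" by (rule forms_plus_beta(2)[OF Suc.prems(1) neg])
  moreover have "Poly_Mapping.lookup ?b k = 1"
    using lookup_beta(2)[of "kminus \<iota> k"]
      kplus_kminus[OF assms(2) forms_plus_beta(1)[OF Suc.prems(1) neg]] by simp
  then have "Poly_Mapping.lookup (\<phi> + ?b) k = - of_nat m"
    using Suc.prems by (simp add: lookup_add)
  ultimately have "- (of_nat m * apply_form ?b a) \<le> apply_form (\<phi> + ?b) a"
    by (rule Suc.IH)
  then show ?case by (simp add: apply_form_add algebra_simps)
qed

text \<open>Only a coefficient -m < 0 at the raised position k can do harm. Minimality of k makes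
  \<sigma> strictly smaller at \<open>kminus \<iota> k\<close>, so \<open>beta\<close> there is at
  most -1 and the form had value at least m before losing m.\<close>

lemma cone_f:
  assumes a: "a \<in> cone" and i: "i \<in> {1..n}"
  shows "a + Poly_Mapping.single (LEAST k. k \<in> Z_M n \<iota> i a) 1 \<in> cone"
proof -
  define k where "k = (LEAST k. k \<in> Z_M n \<iota> i a)"
  have "k \<in> Z_M n \<iota> i a"
    unfolding k_def using Z_M_nonempty[OF i, of a] by (metis LeastI)
  then have k: "1 \<le> k" "\<iota> k = i" "sigma n \<iota> k a = Z_eps n \<iota> i a" by (auto simp: Z_M_def)
  have "0 \<le> apply_form \<phi> (a + Poly_Mapping.single k 1)" if \<phi>: "\<phi> \<in> forms" for \<phi>
  proof (cases "Poly_Mapping.lookup \<phi> k < 0")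
    case False
    then show ?thesis using a \<phi> by (simp add: apply_form_add_single cone_def)
  next
    case True
    let ?k = "kminus \<iota> k"
    note km = kplus_kminus[OF k(1) forms_plus_beta(1)[OF \<phi> True]]
    obtain c where c: "Poly_Mapping.lookup \<phi> k = of_int c"
      using lookup_forms_Ints[OF \<phi>, of k] by (auto elim: Ints_cases)
    define m where "m = nat (- c)"
    have m: "Poly_Mapping.lookup \<phi> k = - of_nat m"
      using True unfolding c m_def by (simp add: of_nat_nat)
    have "?k \<notin> Z_M n \<iota> i a" using km(2) not_less_Least unfolding k_def by blast
    then have "sigma n \<iota> ?k a < sigma n \<iota> k a"
      using sigma_le_eps[of ?k i a] km(3,4) k unfolding Z_M_def by auto
    then have "apply_form (beta n \<iota> ?k) a \<le> - 1"
      unfolding apply_beta[OF km(3)] km(1) by linarith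
    then have "of_nat m * apply_form (beta n \<iota> ?k) a \<le> of_nat m * - 1"
      by (intro mult_left_mono) simp_all
    then show ?thesis
      using form_ge_beta_kminus[OF a k(1) \<phi> m] m by (simp add: apply_form_add_single)
  qed
  moreover have "a + Poly_Mapping.single k 1 \<in> Z_inf"
    using a k(1) by (simp add: cone_def Z_inf_def lookup_add lookup_single)
  ultimately show ?thesis unfolding k_def[symmetric] by (simp add: cone_def)
qed

lemma Max_Z_M:
  assumes i: "i \<in> {1..n}" and eps: "0 < Z_eps n \<iota> i a"
  defines "k \<equiv> Max (Z_M n \<iota> i a)"
  shows "1 \<le> k" "\<iota> k = i" "sigma n \<iota> k a = Z_eps n \<iota> i a"
    and "\<And>j. k < j \<Longrightarrow> \<iota> j = i \<Longrightarrow> sigma n \<iota> j a < Z_eps n \<iota> i a"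
proof -
  have "Z_M n \<iota> i a \<noteq> {}" using Z_M_nonempty[OF i, of a] by blast
  then have "k \<in> Z_M n \<iota> i a" unfolding k_def by (intro Max_in Z_M_finite[OF eps])
  then show k: "1 \<le> k" "\<iota> k = i" "sigma n \<iota> k a = Z_eps n \<iota> i a" by (auto simp: Z_M_def)
  fix j assume j: "k < j" "\<iota> j = i"
  then have "j \<notin> Z_M n \<iota> i a"
    using Max_ge[OF Z_M_finite[OF eps], of j] unfolding k_def by auto
  then show "sigma n \<iota> j a < Z_eps n \<iota> i a"
    using sigma_le_eps[of j i a] j k(1) by (auto simp: Z_M_def)
qed

text \<open>Dual to \<open>cone_f\<close>: maximality of k makes \<sigma> drop by at least 1 from k
  to \<open>kplus \<iota> k\<close>, so \<beta>_k is at least 1 and a coefficient m > 0 forces the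
  form to be at least m.\<close>

lemma cone_e:
  assumes a: "a \<in> cone" and i: "i \<in> {1..n}" and eps: "0 < Z_eps n \<iota> i a"
  shows "a - Poly_Mapping.single (Max (Z_M n \<iota> i a)) 1 \<in> cone"
proof -
  define k where "k = Max (Z_M n \<iota> i a)"
  note k = Max_Z_M[OF i eps, folded k_def]
  have "1 \<le> sigma n \<iota> k a - sigma n \<iota> (kplus \<iota> k) a"
    using k(3) k(4)[of "kplus \<iota> k"] kplus_props[OF k(1)] k(2) by simp
  then have beta: "1 \<le> apply_form (beta n \<iota> k) a"
    unfolding apply_beta[OF k(1)] by linarith
  have diff: "a - Poly_Mapping.single k 1 = a + Poly_Mapping.single k (- 1)"
    by (simp add: single_uminus)
  have "0 \<le> apply_form \<phi> (a + Poly_Mapping.single k (- 1))" if \<phi>: "\<phi> \<in> forms" for \<phi>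
  proof (cases "0 < Poly_Mapping.lookup \<phi> k")
    case False
    moreover have "0 \<le> apply_form \<phi> a" using a \<phi> by (simp add: cone_def)
    ultimately show ?thesis by (simp add: apply_form_add_single)
  next
    case True
    obtain c where c: "Poly_Mapping.lookup \<phi> k = of_int c"
      using lookup_forms_Ints[OF \<phi>, of k] by (auto elim: Ints_cases)
    define m where "m = nat c"
    have m: "Poly_Mapping.lookup \<phi> k = of_nat m"
      using True unfolding c m_def by (simp add: of_nat_nat)
    have "of_nat m * 1 \<le> of_nat m * apply_form (beta n \<iota> k) a"
      using beta by (intro mult_left_mono) simp_all
    then show ?thesis
      using form_ge_beta[OF a k(1) \<phi> m] m by (simp add: apply_form_add_single)
  qed
  moreover have "a + Poly_Mapping.single k (- 1) \<in> Z_inf"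
    using a k(1) by (simp add: cone_def Z_inf_def lookup_add lookup_single)
  ultimately show ?thesis unfolding k_def[symmetric] diff by (simp add: cone_def)
qed

text \<open>Lowering a_k by one lowers \<sigma> by 1 at k, by 2 at earlier positions of index i, and
  not at later ones, where it was already below the maximum. Hence the maximum drops by one and k is
  the first position attaining it.\<close>

lemma f_after_e:
  assumes i: "i \<in> {1..n}" and eps: "0 < Z_eps n \<iota> i a"
  defines "k \<equiv> Max (Z_M n \<iota> i a)"
  shows "(LEAST j. j \<in> Z_M n \<iota> i (a - Poly_Mapping.single k 1)) = k"
proof -
  define b where "b = a + Poly_Mapping.single k (- 1)"
  have b: "a - Poly_Mapping.single k 1 = b" by (simp add: b_def single_uminus)
  note k = Max_Z_M[OF i eps, folded k_def]
  have sig: "sigma n \<iota> j b = sigma n \<iota> j a - (if j = k then 1 else if j < k then 2 else 0)"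
    if "\<iota> j = i" for j
    using that k(2) by (simp add: b_def sigma_add_single cartan_def)
  have le: "sigma n \<iota> j b \<le> Z_eps n \<iota> i a - 1" if "1 \<le> j" "\<iota> j = i" for j
    using sig[OF that(2)] sigma_le_eps[OF that, of a] k(3) k(4)[of j] that(2)
    by (cases j k rule: linorder_cases) simp_all
  have sk: "sigma n \<iota> k b = Z_eps n \<iota> i a - 1" using sig[OF k(2)] k(3) by simp
  obtain j where "j \<in> Z_M n \<iota> i b" by (rule Z_M_nonempty[OF i])
  then have "Z_eps n \<iota> i b = Z_eps n \<iota> i a - 1"
    using le[of j] sigma_le_eps[OF k(1,2), of b] sk by (auto simp: Z_M_def)
  then have M: "Z_M n \<iota> i b = {j. 1 \<le> j \<and> \<iota> j = i \<and> sigma n \<iota> j b = Z_eps n \<iota> i a - 1}"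
    by (simp add: Z_M_def)
  show ?thesis
    unfolding b
  proof (rule Least_equality)
    show "k \<in> Z_M n \<iota> i b" using k sk by (simp add: M)
  next
    fix j assume j: "j \<in> Z_M n \<iota> i b"
    show "k \<le> j"
    proof (rule ccontr)
      assume "\<not> k \<le> j"
      then show False
        using j sig[of j] sigma_le_eps[of j i a] by (auto simp: M)
    qed
  qed
qed

definition total :: "(nat \<Rightarrow>\<^sub>0 int) \<Rightarrow> int" where
  "total a = (\<Sum>k\<in>Poly_Mapping.keys a. Poly_Mapping.lookup a k)"

lemma cone_coord_nonneg:
  assumes "a \<in> cone"
  shows "0 \<le> Poly_Mapping.lookup a k"
proof (cases "1 \<le> k")
  case True
  then have "0 \<le> apply_form (xform k) a" using assms xform_in_forms by (simp add: cone_def)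
  then show ?thesis by (simp add: xform_def apply_form_single)
next
  case False
  then show ?thesis using assms by (simp add: cone_def Z_inf_def not_le)
qed

text \<open>At the last nonzero coordinate $k$ one has $\sigma_k(\mathbf a) = a_k > 0$.\<close>
lemma cone_eps_pos:
  assumes a: "a \<in> cone" and "a \<noteq> 0"
  obtains i where "i \<in> {1..n}" "0 < Z_eps n \<iota> i a"
proof -
  define k where "k = Max (Poly_Mapping.keys a)"
  have "k \<in> Poly_Mapping.keys a" unfolding k_def using assms(2) by (intro Max_in) auto
  then have nz: "Poly_Mapping.lookup a k \<noteq> 0" by (simp add: in_keys_iff)
  then have k: "1 \<le> k" using a by (cases "k = 0") (auto simp: cone_def Z_inf_def)
  have empty: "{j \<in> Poly_Mapping.keys a. k < j} = {}"
    unfolding k_def using Max_ge[OF finite_keys, of _ a] by (auto simp: not_less[symmetric])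
  have "sigma n \<iota> k a = Poly_Mapping.lookup a k" unfolding sigma_def empty by simp
  then have "0 < Z_eps n \<iota> (\<iota> k) a"
    using sigma_le_eps[OF k refl, of a] cone_coord_nonneg[OF a, of k] nz by linarith
  then show thesis using \<iota>_range[OF k] that by blast
qed

section \<open>The image of the embedding\<close>

text \<open>In \<open>Z_crystal\<close> the operator \<open>ft\<close> never gives
  \<open>None\<close>. Strictness carries this back, so \<open>ftil0 n i b\<close> is not the zero
  class.\<close>

lemma Psi_ftil0:
  assumes \<Psi>: "is_Psi n \<iota> \<Psi>" and b: "b \<in> B_inf n" and i: "i \<in> {1..n}"
  shows "ftil0 n i b \<in> B_inf n"
    and "\<Psi> (ftil0 n i b) = \<Psi> b + Poly_Mapping.single (LEAST k. k \<in> Z_M n \<iota> i (\<Psi> b)) 1"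
proof -
  have "ft (Z_crystal n \<iota>) i (\<Psi> b) = map_option \<Psi> (ft (B_inf_crystal n) i b)"
    using \<Psi> b i unfolding is_Psi_def strict_embedding_def by (simp add: B_inf_crystal_def)
  then have *: "Some (\<Psi> b + Poly_Mapping.single (LEAST k. k \<in> Z_M n \<iota> i (\<Psi> b)) 1) =
      map_option \<Psi> (nonzero_class n (ftil0 n i b))"
    by (simp add: Z_crystal_def B_inf_crystal_def)
  then have "ftil0 n i b \<noteq> qL_inf n" by (auto simp: nonzero_class_def)
  then show "ftil0 n i b \<in> B_inf n"
    and "\<Psi> (ftil0 n i b) = \<Psi> b + Poly_Mapping.single (LEAST k. k \<in> Z_M n \<iota> i (\<Psi> b)) 1"
    using * b i by (auto simp: nonzero_class_def intro: B_inf.step)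
qed

lemma Psi_image_subset:
  assumes \<Psi>: "is_Psi n \<iota> \<Psi>"
  shows "\<Psi> ` B_inf n \<subseteq> cone"
proof -
  have "\<Psi> b \<in> cone" if "b \<in> B_inf n" for b
    using that
  proof induction
    case base
    have "\<Psi> (u_inf n) = 0" using \<Psi> by (simp add: is_Psi_def)
    then show ?case by (simp add: cone_def Z_inf_def apply_form_def)
  next
    case (step b i)
    then show ?case using cone_f Psi_ftil0(2)[OF \<Psi>] by simp
  qed
  then show ?thesis by blast
qed

text \<open>Lowering stays in the cone and reduces the coordinate sum, which is nonnegative there.
  By \<open>f_after_e\<close> each lowering step is undone by the operator that \<Psi> intertwines,
  so preimages lift back.\<close>

lemma cone_subset_Psi_image:
  assumes \<Psi>: "is_Psi n \<iota> \<Psi>" and "a \<in> cone"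
  shows "a \<in> \<Psi> ` B_inf n"
  using assms(2)
proof (induction "nat (total a)" arbitrary: a rule: less_induct)
  case less
  show ?case
  proof (cases "a = 0")
    case True
    then have "a = \<Psi> (u_inf n)" using \<Psi> by (simp add: is_Psi_def)
    then show ?thesis using B_inf.base by blast
  next
    case False
    obtain i where i: "i \<in> {1..n}" and eps: "0 < Z_eps n \<iota> i a"
      using cone_eps_pos[OF less.prems False] .
    define b where "b = a - Poly_Mapping.single (Max (Z_M n \<iota> i a)) 1"
    have b: "b \<in> cone" unfolding b_def by (rule cone_e[OF less.prems i eps])
    have a: "a = b + Poly_Mapping.single (Max (Z_M n \<iota> i a)) 1" by (simp add: b_def)
    have "total (p + q) = total p + total q" for p q
      unfolding total_def by (rule setsum_keys_plus_distrib[where f = "\<lambda>_ x. x"]) simp_all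
    then have "total a = total b + total (Poly_Mapping.single (Max (Z_M n \<iota> i a)) 1)"
      using a by metis
    moreover have "0 \<le> total b"
      unfolding total_def by (intro sum_nonneg cone_coord_nonneg[OF b])
    ultimately have "nat (total b) < nat (total a)" by (simp add: total_def)
    then obtain c where c: "c \<in> B_inf n" "b = \<Psi> c" using less.hyps b by blast
    have "\<Psi> (ftil0 n i c) = a"
      using Psi_ftil0(2)[OF \<Psi> c(1) i] f_after_e[OF i eps] a
      unfolding c(2)[symmetric] b_def[symmetric] by simp
    then show ?thesis using Psi_ftil0(1)[OF \<Psi> c(1) i] by blast
  qed
qed

end

theorem theorem4p5:
  fixes n :: nat and \<iota> :: "nat \<Rightarrow> nat"
  assumes "n \<ge> 3"
    and "index_sequence n \<iota>"
    and "adapted n \<iota>"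
  shows "Xi'_positive n \<iota> \<and>
    (\<forall>\<Psi>. is_Psi n \<iota> \<Psi> \<longrightarrow>
       \<Psi> ` B_inf n =
         {a \<in> Z_inf. \<forall>k\<in>{1..int n}. \<forall>s\<ge>1. \<forall>T\<in>EYD k. apply_form (L_form n \<iota> s k T) a \<ge> 0})"
proof -
  interpret adapted_sequence n \<iota> by standard (fact assms)+
  have "cone =
      {a \<in> Z_inf. \<forall>k\<in>{1..int n}. \<forall>s\<ge>1. \<forall>T\<in>EYD k. apply_form (L_form n \<iota> s k T) a \<ge> 0}"
    unfolding cone_def forms_def by blast
  then show ?thesis
    using Xi'_positive Psi_image_subset cone_subset_Psi_image by blast
qed

end
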